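(* Let $v_n$ be the maximum expected length of an increasing subsequence that can be selected by an online (non-anticipating) policy from $n$ independent random variables uniformly distributed on $[0,1]$. Let $\hat v_n$ be the expected length of the increasing subsequence selected from these $n$ items by the following state-dependent policy: if $z$ is the last item selected so far ($z=0$ if nothing has been selected yet), then the $k$th-to-last item, with value $x$, is accepted if and only if $$0<\frac{x-z}{1-z}\le\sqrt{\frac{2}{k(1-z)}}.$$ Then this policy is within a constant of optimality, uniformly in $n$: $$\sup_{n\ge 1}\,(v_n-\hat v_n)<\infty .$$
   Context: Online selection problem with fixed sample size $n$: items $X_1,\dots,X_n$, i.i.d. uniform on $[0,1]$, are observed one at a time. At time $i$, upon observing $X_i$, the decision maker must irrevocably accept or reject $X_i$, using only the information in $X_1,\dots,X_i$; the accepted items must form an increasing sequence. Formally, a policy is a sequence of stopping times $\tau_1<\tau_2<\cdots$ (with value $\infty$ if no further selection is made) with respect to the filtration generated by $X_1,\dots,X_n$, such that $X_{\tau_1}<X_{\tau_2}<\cdots$ along the finite stopping times. The length of the selected subsequence is $\max\{j:\tau_j\le n\}$ (and $0$ if no item is selected), and $v_n$ is the maximum of its expectation over all policies. The $k$th-to-last item is $X_{n-k+1}$ (so $X_n$ is the case $k=1$). For $z\in[0,1]$ let $v_k(z)$ be the maximum expected length in the problem with $k$ items when only items bigger than $z$ may be selected, so that $v_n=v_n(0)$. It is known that these functions are determined by the dynamic programming recursion $$v_k(z)=z\,v_{k-1}(z)+\int_z^1\max\{v_{k-1}(x)+1,\;v_{k-1}(z)\}\,\mathrm{d}x,\qquad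 k\ge 1,\qquad v_0(z)=0.$$ *)

theory Defs
  imports "HOL-Probability.Probability" "HOL-Library.Extended_Nat"
begin

text \<open>The \<open>\<sigma>\<close>-algebra at time \<open>t\<close> is generated by the items \<open>X 1, \<dots>, X n\<close> with index at most
  \<open>t\<close>; the time axis is \<^typ>\<open>enat\<close> because stopping times may take the value \<open>\<infinity>\<close>.\<close>

definition item_filtration ::
  "'a measure \<Rightarrow> (nat \<Rightarrow> 'a \<Rightarrow> real) \<Rightarrow> nat \<Rightarrow> enat \<Rightarrow> 'a measure" where
  "item_filtration M X n t =
     sigma (space M) {X i -` A \<inter> space M | i A. i \<in> {1..n} \<and> enat i \<le> t \<and> A \<in> sets borel}"

text \<open>\<open>\<tau> j\<close>, for \<open>j \<ge> 1\<close>, is the time of the \<open>j\<close>-th selection; \<open>\<tau> 0\<close> is irrelevant. The relation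
  \<open>\<tau>\<^sub>j < \<tau>\<^sub>j\<^sub>+\<^sub>1\<close> is read with the convention that \<open>\<tau>\<^sub>j = \<infinity>\<close> forces \<open>\<tau>\<^sub>j\<^sub>+\<^sub>1 = \<infinity>\<close>.\<close>

definition online_policy ::
  "'a measure \<Rightarrow> (nat \<Rightarrow> 'a \<Rightarrow> real) \<Rightarrow> nat \<Rightarrow> (nat \<Rightarrow> 'a \<Rightarrow> enat) \<Rightarrow> bool" where
  "online_policy M X n \<tau> \<longleftrightarrow>
     (\<forall>j\<ge>1. stopping_time (item_filtration M X n) (\<tau> j)) \<and>
     (\<forall>j\<ge>1. \<forall>\<omega>\<in>space M.
        \<tau> j \<omega> \<in> insert \<infinity> (enat ` {1..n}) \<and>
        (\<tau> j \<omega> < \<tau> (Suc j) \<omega> \<or> \<tau> j \<omega> = \<infinity> \<and> \<tau> (Suc j) \<omega> = \<infinity>) \<and>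
        (\<tau> (Suc j) \<omega> \<noteq> \<infinity> \<longrightarrow> X (the_enat (\<tau> j \<omega>)) \<omega> < X (the_enat (\<tau> (Suc j) \<omega>)) \<omega>))"

definition selected_length :: "nat \<Rightarrow> (nat \<Rightarrow> 'a \<Rightarrow> enat) \<Rightarrow> 'a \<Rightarrow> nat" where
  "selected_length n \<tau> \<omega> = Max (insert 0 {j. 1 \<le> j \<and> \<tau> j \<omega> \<le> enat n})"

definition optimal_value :: "'a measure \<Rightarrow> (nat \<Rightarrow> 'a \<Rightarrow> real) \<Rightarrow> nat \<Rightarrow> real" where
  "optimal_value M X n =
     (SUP \<tau>\<in>{\<tau>. online_policy M X n \<tau>}. \<integral>\<omega>. real (selected_length n \<tau> \<omega>) \<partial>M)"

text \<open>Acceptance of the \<open>k\<close>-th-to-last item with value \<open>x\<close> when \<open>z\<close> is the last selected item.\<close>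

definition accepts :: "nat \<Rightarrow> real \<Rightarrow> real \<Rightarrow> bool" where
  "accepts k z x \<longleftrightarrow>
     0 < (x - z) / (1 - z) \<and> (x - z) / (1 - z) \<le> sqrt (2 / (real k * (1 - z)))"

text \<open>\<open>last_selected n x i\<close> is the last item selected among the first \<open>i\<close> of the \<open>n\<close> items
  \<open>x 1, \<dots>, x n\<close>. Item \<open>Suc i\<close> is the \<open>(n - i)\<close>-th-to-last one.\<close>

primrec last_selected :: "nat \<Rightarrow> (nat \<Rightarrow> real) \<Rightarrow> nat \<Rightarrow> real" where
  "last_selected n x 0 = 0"
| "last_selected n x (Suc i) =
     (if accepts (n - i) (last_selected n x i) (x (Suc i)) then x (Suc i)
      else last_selected n x i)"

definition heuristic_length :: "nat \<Rightarrow> (nat \<Rightarrow> real) \<Rightarrow> nat" where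
  "heuristic_length n x =
     card {i. i < n \<and> accepts (n - i) (last_selected n x i) (x (Suc i))}"

definition heuristic_value :: "'a measure \<Rightarrow> (nat \<Rightarrow> 'a \<Rightarrow> real) \<Rightarrow> nat \<Rightarrow> real" where
  "heuristic_value M X n = (\<integral>\<omega>. real (heuristic_length n (\<lambda>i. X i \<omega>)) \<partial>M)"

end

(* Write \<open>N = k (1 - z)\<close> and \<open>p = sqrt (2 N)\<close>. The dynamic programming recursion has the
   approximate solution \<open>p - ln p / 6\<close>, and its linearisation around this function turns a perturbation
   \<open>c / p\<close> into a residual of order \<open>c / p\<close>, with a definite sign. All neglected terms have order
   \<open>1 / p\<close> too, so for large \<open>p\<close> the function \<open>p - ln p / 6 - 4 / p\<close> is a supersolution of the
   recursion for the optimal value, and \<open>p - ln p / 6 + 4 / p\<close> is a subsolution of the recursion for the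
   value of the heuristic policy. Truncation at small \<open>p\<close> costs additive constants only. Along any
   policy, the number of selected items plus the supersolution at the current state is a
   supermartingale; along the heuristic policy the same expression with the subsolution is a
   submartingale. Hence the two values differ by a bounded amount. *)

theory Submission
  imports Defs "HOL-Real_Asymp.Real_Asymp"
begin

section \<open>Integration against the uniform distribution\<close>

abbreviation (input) unit_uniform :: "real measure" where
  "unit_uniform \<equiv> uniform_measure lborel {0..1}"

lemma unit_uniform_eq_density: "unit_uniform = density lborel (\<lambda>x. ennreal (indicator {0..1} x))"
  unfolding uniform_measure_def by (intro density_cong) (auto split: split_indicator)

lemma prob_space_unit_uniform: "prob_space unit_uniform"
  by (rule prob_space_uniform_measure) auto

lemma AE_unit_uniform: "AE x in unit_uniform. x \<in> {0..1}"
  by (rule AE_uniform_measureI) auto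

lemma integrable_unit_uniform_bounded:
  fixes f :: "real \<Rightarrow> real"
  assumes "f \<in> borel_measurable borel" "\<And>x. x \<in> {0..1} \<Longrightarrow> \<bar>f x\<bar> \<le> B"
  shows "integrable unit_uniform f"
proof -
  interpret prob_space unit_uniform by (rule prob_space_unit_uniform)
  show ?thesis
    by (rule integrable_const_bound[where B = B])
      (use assms in \<open>auto intro: eventually_mono[OF AE_unit_uniform]\<close>)
qed

text \<open>The fundamental theorem of calculus transfers to the uniform law because its density is
  1 on the unit interval. The gains over the acceptance windows below are computed this way.\<close>

lemma integral_unit_uniform_window:
  fixes f F :: "real \<Rightarrow> real"
  assumes "f \<in> borel_measurable borel" "0 \<le> a" "a \<le> b" "b \<le> 1"
    and "\<And>x. a \<le> x \<Longrightarrow> x \<le> b \<Longrightarrow> DERIV F x :> f x"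
    and "\<And>x. a \<le> x \<Longrightarrow> x \<le> b \<Longrightarrow> isCont f x"
  shows "integrable unit_uniform (\<lambda>x. f x * indicator {a..b} x)" (is ?int)
    and "(\<integral>x. f x * indicator {a..b} x \<partial>unit_uniform) = F b - F a" (is ?eq)
proof -
  note [measurable] = assms(1)
  have "has_bochner_integral lborel (\<lambda>x. f x * indicator {a..b} x) (F b - F a)"
    using assms by (intro has_bochner_integral_FTC_Icc_real) auto
  moreover have "(\<lambda>x. indicator {0..1} x *\<^sub>R (f x * indicator {a..b} x)) = (\<lambda>x. f x * indicator {a..b} x)"
    using assms by (auto split: split_indicator)
  ultimately show ?int ?eq
    unfolding unit_uniform_eq_density
    by (simp_all add: integrable_density integral_density has_bochner_integral_iff
        del: real_scaleR_def)
qed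

section \<open>Supersolution and subsolution\<close>

definition super_profile :: "real \<Rightarrow> real" where
  "super_profile p = p - ln p / 6 - 4 / p"

definition sub_profile :: "real \<Rightarrow> real" where
  "sub_profile p = p - ln p / 6 + 4 / p"

text \<open>Slopes in \<open>q\<close> of linear minorants of \<open>G p - G q\<close>, \<open>0 \<le> p - q \<le> 2\<close>, resp. majorants of
  \<open>H p - H q\<close>, for the two profiles \<open>G p = p - ln p / 6 - 4 / p\<close> and \<open>H p = p - ln p / 6 + 4 / p\<close>; the
  constant \<open>11 / 3\<close> is \<open>4 - 2 / 6\<close>.\<close>

definition super_slope :: "real \<Rightarrow> real" where
  "super_slope p = 1 - 1 / (6 * p) + (11/3) / p^2"

definition sub_slope :: "real \<Rightarrow> real" where
  "sub_slope p = 1 - 1 / (6 * p) - 4 / p^2"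

section \<open>Asymptotic inequalities behind the one-step estimates\<close>

text \<open>Both sides are \<open>p / 2 - 1 / 12 + O(1 / p)\<close>, with \<open>1 / p\<close>
  coefficients \<open>- 15 / 8\<close> on the left and \<open>3 / 2\<close> on the right. Equality
  of the constant terms is what singles out the factor \<open>1 / 6\<close> of the
  logarithm.\<close>

lemma eventually_super_step:
  "eventually (\<lambda>p. p / (2 * super_slope p) - 1 / (6 * (super_slope p)^2)
     \<le> p^2 / (2 * sqrt (p^2 + 2)) * (1 - 1 / (6 * p) + 4 / (p^2 + 2))) at_top"
  unfolding super_slope_def by real_asymp

text \<open>Again both sides are \<open>p / 2 - 1 / 12 + O(1 / p)\<close>; the coefficients of
  \<open>1 / p\<close> are now \<open>- 2\<close> on the left and \<open>19 / 36\<close> on the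
  right.\<close>

lemma eventually_sub_step:
  "eventually (\<lambda>p. p / 2 * (1 - 1 / (6 * sqrt (p^2 + 2)) - 4 / (p^2 + 2))
     \<le> p / sqrt (p^2 + 2) * (p - sub_slope p * (p / 2 + 1 / 6 + 1 / p))) at_top"
  unfolding sub_slope_def by real_asymp

lemma eventually_slopes:
  "eventually (\<lambda>p. 1/2 \<le> super_slope p \<and> 0 \<le> sub_slope p \<and>
     0 \<le> p - sub_slope p * (p / 2 + 1 / 6 + 1 / p)) at_top"
  unfolding super_slope_def sub_slope_def by (intro eventually_conj; real_asymp)

section \<open>Increments of the two profiles\<close>

lemma ln_ratio_bounds:
  fixes p q :: real
  assumes "0 < q" "q \<le> p"
  shows "(p - q) / p \<le> ln p - ln q" "ln p - ln q \<le> (p - q) / q"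
proof -
  have "ln (q / p) \<le> q / p - 1" "ln (p / q) \<le> p / q - 1"
    using assms by (auto intro!: ln_le_minus_one)
  then show "(p - q) / p \<le> ln p - ln q" "ln p - ln q \<le> (p - q) / q"
    using assms by (simp_all add: ln_div diff_divide_distrib)
qed

text \<open>The derivative \<open>1 - 1 / (6 * s) + 4 / s^2\<close> is bounded below term by term:
  on the interval the second term is smallest at \<open>s = q\<close>, the third at
  \<open>s = p\<close> and hence no smaller than at \<open>B\<close>.\<close>

lemma super_profile_diff_ge:
  fixes p q B :: real
  assumes "0 < q" "q \<le> p" "p \<le> B"
  shows "(p - q) * (1 - 1 / (6 * q) + 4 / B^2) \<le> super_profile p - super_profile q"
proof -
  have "4 * (p - q) / B^2 \<le> 4 * (p - q) / (p * q)"
    using assms by (intro divide_left_mono mult_nonneg_nonneg mult_pos_pos)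
      (auto simp: power2_eq_square intro!: mult_mono)
  also have "\<dots> = 4 / q - 4 / p" using assms by (simp add: field_simps)
  finally have "4 * (p - q) / B^2 \<le> 4 / q - 4 / p" .
  with ln_ratio_bounds(2)[OF assms(1,2)] show ?thesis
    unfolding super_profile_def by (simp add: algebra_simps)
qed

text \<open>The slope must stay constant while \<open>q\<close> varies, so it is taken at
  \<open>p\<close>. Exchanging \<open>w / q\<close> for \<open>w / p\<close> in the logarithm costs
  \<open>w^2 / (p * q)\<close>, at most \<open>2 * w / (p * q)\<close>; the increment of
  \<open>- 4 / p\<close> pays for it, and \<open>4 - 2 / 6\<close> of its factor survives.\<close>

lemma super_profile_diff_ge_slope:
  fixes p q :: real
  assumes "0 < q" "q \<le> p" "p - q \<le> 2"
  shows "super_slope p * (p - q) \<le> super_profile p - super_profile q"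
proof -
  define w where "w = p - q"
  have w: "0 \<le> w" "w \<le> 2" "p = q + w" "0 < p" using assms by (auto simp: w_def)
  have "w / q - w / p = w * (p - q) / (p * q)"
    using \<open>0 < p\<close> \<open>0 < q\<close> by (simp add: field_simps)
  then have "w / q = w / p + w^2 / (p * q)"
    by (simp add: w_def power2_eq_square)
  also have "w^2 / (p * q) \<le> 2 * w / (p * q)"
    using w assms by (intro divide_right_mono) (auto simp: power2_eq_square intro!: mult_right_mono)
  finally have "ln p - ln q \<le> w / p + 2 * (w / (p * q))"
    using ln_ratio_bounds(2)[OF assms(1,2)] by (simp add: w_def)
  moreover have "4 / q - 4 / p = 4 * (w / (p * q))"
    using \<open>0 < p\<close> \<open>0 < q\<close> by (simp add: w_def field_simps)
  moreover have "w / p^2 \<le> w / (p * q)"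
    using w assms by (intro divide_left_mono) (auto simp: power2_eq_square)
  ultimately have "(11/3) * (w / p^2) - w / p / 6 \<le> 4 / q - 4 / p - (ln p - ln q) / 6"
    by argo
  moreover have "super_slope p * w = w - w / p / 6 + (11/3) * (w / p^2)"
    by (simp add: super_slope_def algebra_simps)
  ultimately show ?thesis
    unfolding super_profile_def w_def[symmetric] using w(3) by argo
qed

lemma super_profile_mono:
  assumes "3 \<le> q" "q \<le> p" shows "super_profile q \<le> super_profile p"
proof -
  have "1 / (6 * q) \<le> 1" using assms by (simp add: field_simps)
  then have "0 \<le> (p - q) * (1 - 1 / (6 * q) + 4 / p^2)"
    using assms by (intro mult_nonneg_nonneg add_nonneg_nonneg) auto
  then show ?thesis using super_profile_diff_ge[of q p p] assms by linarith
qed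

text \<open>The derivative \<open>1 - 1 / (6 * s) - 4 / s^2\<close> increases with \<open>s\<close>,
  so its value at \<open>B\<close> serves on the whole interval.\<close>

lemma sub_profile_diff_le:
  fixes p q B :: real
  assumes "0 < q" "q \<le> p" "p \<le> B"
  shows "sub_profile p - sub_profile q \<le> (p - q) * (1 - 1 / (6 * B) - 4 / B^2)"
proof -
  have "4 * (p - q) / B^2 \<le> 4 * (p - q) / (p * q)"
    using assms by (intro divide_left_mono mult_nonneg_nonneg mult_pos_pos)
      (auto simp: power2_eq_square intro!: mult_mono)
  also have "\<dots> = 4 / q - 4 / p" using assms by (simp add: field_simps)
  finally have "4 * (p - q) / B^2 \<le> 4 / q - 4 / p" .
  moreover have "(p - q) / B \<le> (p - q) / p"
    using assms by (intro divide_left_mono) auto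
  ultimately show ?thesis
    using ln_ratio_bounds(1)[OF assms(1,2)]
    unfolding sub_profile_def by (simp add: algebra_simps)
qed

lemma sub_profile_diff_le_slope:
  assumes "0 < q" "q \<le> p"
  shows "sub_profile p - sub_profile q \<le> sub_slope p * (p - q)"
  using sub_profile_diff_le[OF assms order_refl] by (simp add: sub_slope_def mult.commute)

lemma sub_profile_mono:
  assumes "3 \<le> q" "q \<le> p" shows "sub_profile q \<le> sub_profile p"
proof -
  have "4 / q - 4 / p = 4 * (p - q) / (p * q)" using assms by (simp add: field_simps)
  also have "\<dots> \<le> 4 * (p - q) / 9"
    using assms mult_mono[of 3 p 3 q] by (intro divide_left_mono) auto
  finally have "4 / q - 4 / p \<le> 4 * (p - q) / 9" .
  moreover have "ln p - ln q \<le> (p - q) / 3"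
    using ln_ratio_bounds(2)[of q p] assms
    by (intro order_trans[OF _ divide_left_mono[of 3 q "p - q"]]) auto
  ultimately show ?thesis using assms(2) unfolding sub_profile_def by argo
qed

text \<open>The Taylor coefficient of \<open>x^3\<close> is \<open>- 1 / 16\<close>; lowering it to
  \<open>- 1 / 2\<close> absorbs all higher terms for \<open>x \<le> 1/2\<close>.\<close>

lemma sqrt_one_minus_ge:
  fixes x :: real
  assumes "0 \<le> x" "x \<le> 1/2"
  shows "1 - x / 2 - x^2 / 8 - x^3 / 2 \<le> sqrt (1 - x)"
proof (rule real_le_rsqrt)
  \<comment> \<open>This is the square of the polynomial minus \<open>1 - x\<close>, in Horner form;
    the bracket grows with \<open>x\<close> and is still negative at \<open>1/2\<close>.\<close>
  have "x^3 * (-7/8 + x * (33/64 + x * (1/8 + x * (1/4)))) \<le> x^3 * (-7/8 + (1/2) * (33/64 + (1/2) * (1/8 + (1/2) * (1/4))))"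
    using assms by (intro mult_left_mono add_mono mult_mono) auto
  also have "\<dots> \<le> 0" using assms by simp
  finally show "(1 - x / 2 - x^2 / 8 - x^3 / 2)^2 \<le> 1 - x"
    by (simp add: algebra_simps power2_eq_square power3_eq_cube)
qed

lemma sqrt_drop_le:
  fixes p u :: real
  assumes "0 < p" "0 \<le> u" "4 * u \<le> p^2"
  shows "p - sqrt (p^2 - 2 * u) \<le> u / p + u^2 / (2 * p^3) + 4 * u^3 / p^5"
proof -
  define x where "x = 2 * u / p^2"
  have x: "0 \<le> x" "x \<le> 1/2" using assms by (auto simp: x_def field_simps)
  have "p^2 - 2 * u = p^2 * (1 - x)" using assms by (simp add: x_def field_simps)
  then have s: "sqrt (p^2 - 2 * u) = p * sqrt (1 - x)" using assms by (simp add: real_sqrt_mult)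
  have "p - p * sqrt (1 - x) \<le> p * (x / 2 + x^2 / 8 + x^3 / 2)"
    using mult_left_mono[OF sqrt_one_minus_ge[OF x], of p] assms by (simp add: algebra_simps)
  also have "\<dots> = u / p + u^2 / (2 * p^3) + 4 * u^3 / p^5"
    using assms by (simp add: x_def field_simps eval_nat_numeral)
  finally show ?thesis using s by simp
qed

section \<open>Profiles in terms of items left and state, and one-step decisions\<close>

text \<open>From 3 on both profiles increase: at 3 the derivative of \<open>sub_profile\<close> is
  \<open>1 - 1/18 - 4/9 > 0\<close>. Clipping also avoids the singularity at argument 0, which is
  reached for \<open>k = 0\<close> or \<open>z = 1\<close>.\<close>

definition clipped_super :: "nat \<Rightarrow> real \<Rightarrow> real" where
  "clipped_super k z = super_profile (max (sqrt (2 * real k * (1 - z))) 3)"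

definition clipped_sub :: "nat \<Rightarrow> real \<Rightarrow> real" where
  "clipped_sub k z = sub_profile (max (sqrt (2 * real k * (1 - z))) 3)"

lemma clipped_measurable [measurable]:
  "clipped_super k \<in> borel_measurable borel" "clipped_sub k \<in> borel_measurable borel"
  unfolding clipped_super_def[abs_def] clipped_sub_def[abs_def] super_profile_def sub_profile_def
  by measurable

lemma clipped_bounds:
  assumes "z \<in> {0..1}"
  shows "super_profile 3 \<le> clipped_super k z" "clipped_super k z \<le> clipped_super k 0"
    "sub_profile 3 \<le> clipped_sub k z" "clipped_sub k z \<le> clipped_sub k 0"
  unfolding clipped_super_def clipped_sub_def using assms
  by (auto intro!: super_profile_mono sub_profile_mono max.mono mult_left_le)

text \<open>Value after an item \<open>x\<close> is seen in state \<open>z\<close>, if \<open>V\<close> gives the value of the remaining problem: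
  for the optimal decision, and for the acceptance rule of the heuristic policy.\<close>

definition greedy_choice :: "(real \<Rightarrow> real) \<Rightarrow> real \<Rightarrow> real \<Rightarrow> real" where
  "greedy_choice V z x = (if z \<le> x then max (V x + 1) (V z) else V z)"

definition window_choice :: "nat \<Rightarrow> (real \<Rightarrow> real) \<Rightarrow> real \<Rightarrow> real \<Rightarrow> real" where
  "window_choice k V z x = (if accepts k z x then V x + 1 else V z)"

lemma choice_measurable [measurable]:
  assumes [measurable]: "V \<in> borel_measurable borel"
  shows "(\<lambda>(z, x). greedy_choice V z x) \<in> borel_measurable (borel \<Otimes>\<^sub>M borel)"
    "(\<lambda>(z, x). window_choice k V z x) \<in> borel_measurable (borel \<Otimes>\<^sub>M borel)"
    "greedy_choice V z \<in> borel_measurable borel"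
    "window_choice k V z \<in> borel_measurable borel"
  unfolding greedy_choice_def[abs_def] window_choice_def[abs_def] accepts_def by measurable

lemma choice_bounded:
  assumes "\<And>x. x \<in> {0..1} \<Longrightarrow> \<bar>V x\<bar> \<le> B" "z \<in> {0..1}" "x \<in> {0..1}"
  shows "\<bar>greedy_choice V z x\<bar> \<le> B + 1" "\<bar>window_choice k V z x\<bar> \<le> B + 1"
  using assms(1)[OF assms(2)] assms(1)[OF assms(3)]
  unfolding greedy_choice_def window_choice_def by auto

lemma choice_integrable:
  assumes "V \<in> borel_measurable borel" "\<And>x. x \<in> {0..1} \<Longrightarrow> \<bar>V x\<bar> \<le> B" "z \<in> {0..1}"
  shows "integrable unit_uniform (greedy_choice V z)"
    "integrable unit_uniform (window_choice k V z)"
  using assms by (auto intro!: integrable_unit_uniform_bounded[where B = "B + 1"] choice_bounded)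

section \<open>One-step inequality for the optimal decision\<close>

text \<open>Accepting \<open>x\<close> gains 1 and loses the drop of the profile from
  \<open>p\<close> to \<open>q x\<close>. A linear minorant of the loss can be integrated exactly;
  up to the factor \<open>1 / m\<close> this gives the left side of \<open>ineq\<close>, whose right
  side bounds the value of one more item from below.\<close>

lemma super_step:
  fixes z C :: real and m :: nat
  defines "p \<equiv> sqrt (2 * real m * (1 - z))"
  defines "a \<equiv> super_slope p"
  assumes z: "z \<in> {0..1}" and p: "5 \<le> p" and a: "1/2 \<le> a"
    and ineq: "p / (2 * a) - 1 / (6 * a^2)
      \<le> p^2 / (2 * sqrt (p^2 + 2)) * (1 - 1 / (6 * p) + 4 / (p^2 + 2))"
  shows "(\<integral>x. greedy_choice (\<lambda>x. clipped_super m x + C) z x \<partial>unit_uniform) \<le> clipped_super (Suc m) z + C"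
proof -
  interpret prob_space unit_uniform by (rule prob_space_unit_uniform)
  define y where "y = 1 - z"
  have m: "0 < m" using p by (cases m) (auto simp: p_def)
  have y: "0 < y" "y \<le> 1" using p z by (auto simp: p_def y_def intro: ccontr)
  have p2: "p^2 = 2 * real m * y" using y by (simp add: p_def y_def)
  define q where "q x = sqrt (2 * real m * (1 - x))" for x
  \<comment> \<open>The linear minorant \<open>a * (p - q x)\<close> of the loss reaches 1 at \<open>x = b\<close>.\<close>
  define b where "b = z + (p / a - 1 / (2 * a^2)) / m"
  define f where "f x = 1 - a * (p - q x)" for x
  \<comment> \<open>An antiderivative of \<open>f\<close>, because \<open>q^3\<close> has derivative
    \<open>- 3 * m * q\<close>.\<close>
  define F where "F x = (1 - a * p) * x - a / (3 * m) * q x ^ 3" for x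
  \<comment> \<open>The bound 2 keeps \<open>p - q x\<close> within the range of the linear minorant
    and, with \<open>5 \<le> p\<close>, keeps \<open>q x\<close> above the clipping level up to
    \<open>b\<close>.\<close>
  have ia: "0 < 1 / a" "1 / a \<le> 2" using a by (auto simp: field_simps)
  have "2 * real m * (1 - b) = p^2 - 2 * (p / a - 1 / (2 * a^2))"
    using m by (simp add: b_def p2 y_def field_simps)
  also have "\<dots> = (p - 1 / a)^2"
    using a by (simp add: field_simps power2_eq_square)
  finally have mb: "2 * real m * (1 - b) = (p - 1 / a)^2" .
  then have qb: "q b = p - 1 / a" using ia p by (simp add: q_def)
  have qz: "q z = p" by (simp add: q_def p_def)
  have "1 / (2 * a^2) \<le> p / a"
  proof -
    have "1 / (2 * a^2) = (1 / a) * (1 / a) / 2" by (simp add: power2_eq_square)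
    also have "\<dots> \<le> (1 / a) * p" using ia p by (intro order_trans[OF _ mult_left_mono[of "1/a/2" p "1/a"]]) auto
    finally show ?thesis by simp
  qed
  then have zb: "z \<le> b" using m by (simp add: b_def)
  have b1: "b \<le> 1"
  proof (rule ccontr)
    assume "\<not> b \<le> 1"
    then have "2 * real m * (1 - b) < 0" using m by (simp add: mult_pos_neg)
    with mb show False by (metis not_less zero_le_power2)
  qed
  have q_le: "q x' \<le> q x" if "x \<le> x'" for x x'
    using that by (auto simp: q_def intro!: mult_left_mono)
  have fm: "f \<in> borel_measurable borel" unfolding f_def[abs_def] q_def[abs_def] by measurable
  have qpos: "0 < 2 * real m * (1 - x)" if "x \<le> b" for x
  proof -
    have "0 < q x" using q_le[OF that] qb ia p by linarith
    then show ?thesis by (simp add: q_def)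
  qed
  have der: "DERIV F x :> f x" if "z \<le> x" "x \<le> b" for x
  proof -
    have q: "0 < q x" using qpos[OF that(2)] by (simp add: q_def)
    have "DERIV q x :> - m / q x"
      unfolding q_def[abs_def] using qpos[OF that(2)]
      by (auto intro!: derivative_eq_intros simp: field_simps)
    then have "DERIV F x :> (1 - a * p) - a / (3 * m) * (3 * q x ^ 2 * (- m / q x))"
      unfolding F_def[abs_def] by (auto intro!: derivative_eq_intros)
    also have "(1 - a * p) - a / (3 * m) * (3 * q x ^ 2 * (- m / q x)) = f x"
      using q m by (simp add: f_def field_simps power2_eq_square)
    finally show ?thesis .
  qed
  have cont: "isCont f x" for x
    unfolding f_def[abs_def] q_def[abs_def] by (intro continuous_intros)
  have "0 \<le> z" using z by simp
  note win = integral_unit_uniform_window[OF fm this zb b1 der cont]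
  have bz: "b - z = (p / a - 1 / (2 * a^2)) / m" by (simp add: b_def)
  have "F b - F z = (1 - a * p) * (b - z) - a / (3 * m) * ((p - 1 / a)^3 - p^3)"
    by (simp add: F_def qb qz algebra_simps)
  also have "\<dots> = (p / (2 * a) - 1 / (6 * a^2)) / m"
    unfolding bz using a m by (simp add: field_simps power2_eq_square power3_eq_cube)
  finally have Fbz: "F b - F z = (p / (2 * a) - 1 / (6 * a^2)) / m" .
  let ?V = "\<lambda>x. clipped_super m x + C"
  have V: "clipped_super m x = super_profile (max (q x) 3)" for x
    by (simp add: clipped_super_def q_def)
  have Vz: "clipped_super m z = super_profile p" using V[of z] qz p by simp
  have pw: "greedy_choice ?V z x \<le> ?V z + f x * indicator {z..b} x" if x: "x \<in> {0..1}" for x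
  proof -
    consider "x < z" | "z \<le> x" "x \<le> b" | "z \<le> x" "b < x" by linarith
    then show ?thesis
    proof cases
      case 1
      then show ?thesis by (simp add: greedy_choice_def)
    next
      case 2
      have q: "p - 1 / a \<le> q x" "q x \<le> p" using q_le[OF 2(1)] q_le[OF 2(2)] qb qz by auto
      then have "super_profile p - super_profile (q x) \<ge> a * (p - q x)"
        unfolding a_def using ia p by (intro super_profile_diff_ge_slope) (auto simp: a_def)
      moreover have "max (q x) 3 = q x" using q ia p by linarith
      moreover have "a * (p - q x) \<le> a * (1 / a)" using q a by (intro mult_left_mono) auto
      ultimately show ?thesis using 2 a p by (simp add: greedy_choice_def V qz f_def)
    next
      case 3
      have q: "q x \<le> p - 1 / a" using q_le[of b x] 3 qb by auto
      have "super_profile (max (q x) 3) \<le> super_profile (p - 1 / a)"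
        using q ia p by (intro super_profile_mono) auto
      moreover have "super_profile p - super_profile (p - 1 / a) \<ge> a * (p - (p - 1 / a))"
        unfolding a_def using ia p by (intro super_profile_diff_ge_slope) (auto simp: a_def)
      ultimately show ?thesis using 3 a p by (simp add: greedy_choice_def V qz)
    qed
  qed
  have "(\<integral>x. greedy_choice ?V z x \<partial>unit_uniform) \<le> (\<integral>x. ?V z + f x * indicator {z..b} x \<partial>unit_uniform)"
  proof (rule integral_mono_AE)
    show "integrable unit_uniform (greedy_choice ?V z)"
      using clipped_bounds(1,2)[of _ m] z
      by (intro choice_integrable[where B = "\<bar>super_profile 3\<bar> + \<bar>clipped_super m 0\<bar> + \<bar>C\<bar>"])
        (auto simp: abs_le_iff, smt+)
    show "AE x in unit_uniform. greedy_choice ?V z x \<le> ?V z + f x * indicator {z..b} x"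
      using pw by (auto intro: eventually_mono[OF AE_unit_uniform])
  qed (use win in auto)
  also have "\<dots> = ?V z + (p / (2 * a) - 1 / (6 * a^2)) / m"
    using win Fbz prob_space by simp
  also have "(p / (2 * a) - 1 / (6 * a^2)) / m \<le> clipped_super (Suc m) z - clipped_super m z"
  proof -
    \<comment> \<open>As \<open>y \<le> 1\<close>, \<open>B\<close> bounds \<open>P\<close> by a
      function of \<open>p\<close> alone, which makes \<open>ineq\<close> a condition on one
      variable.\<close>
    define P B where "P = sqrt (p^2 + 2 * y)" and "B = sqrt (p^2 + 2)"
    have P: "p \<le> P" "P \<le> B" "P^2 = p^2 + 2 * y"
      using y p by (auto simp: P_def B_def intro: real_le_rsqrt)
    have B: "B^2 = p^2 + 2" "0 < B" using p by (auto simp: B_def add_nonneg_pos)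
    have Vs: "clipped_super (Suc m) z = super_profile P"
    proof -
      have "2 * real (Suc m) * (1 - z) = p^2 + 2 * y" by (simp add: p2 y_def algebra_simps)
      then show ?thesis using P p unfolding clipped_super_def by (simp add: P_def)
    qed
    let ?s = "1 - 1 / (6 * p) + 4 / (p^2 + 2)"
    have s: "0 \<le> ?s" using p by (intro add_nonneg_nonneg) (auto simp: field_simps)
    have "(P - p) * (P + p) = 2 * y" using P(3) by (simp add: algebra_simps power2_eq_square)
    moreover have "(P - p) * (P + p) \<le> (P - p) * (2 * B)" using P by (intro mult_left_mono) auto
    ultimately have "y \<le> (P - p) * B" by simp
    then have Pp: "y / B \<le> P - p" using B by (simp add: field_simps)
    have "(p / (2 * a) - 1 / (6 * a^2)) / m \<le> (p^2 / (2 * B) * ?s) / m"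
      using ineq by (intro divide_right_mono) (auto simp: B_def)
    also have "\<dots> = p^2 / (2 * m) / B * ?s" by simp
    also have "p^2 / (2 * m) = y" using m p2 by simp
    also have "y / B * ?s \<le> (P - p) * ?s" using Pp s by (rule mult_right_mono)
    also have "\<dots> \<le> super_profile P - super_profile p"
      using super_profile_diff_ge[of p P B] P p B by simp
    finally show ?thesis by (simp add: Vs Vz)
  qed
  finally show ?thesis by simp
qed

section \<open>One-step inequality for the heuristic window\<close>

text \<open>The threshold of the rule is \<open>2 / P\<close>, where
  \<open>P = sqrt (2 * k * (1 - z))\<close> is the argument of the profiles. To first order, an item
  at the end of the window lowers this argument by 1.\<close>

lemma accepts_iff:
  assumes "z < 1" "0 < k"
  shows "accepts k z x \<longleftrightarrow> z < x \<and> x \<le> z + 2 * (1 - z) / sqrt (2 * real k * (1 - z))"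
proof -
  have "sqrt (2 / (real k * (1 - z))) = sqrt (4 / (2 * real k * (1 - z)))" by simp
  also have "\<dots> = 2 / sqrt (2 * real k * (1 - z))"
    by (simp only: real_sqrt_divide real_sqrt_four)
  finally have "sqrt (2 / (real k * (1 - z))) = 2 / sqrt (2 * real k * (1 - z))" .
  then have "(x - z) / (1 - z) \<le> sqrt (2 / (real k * (1 - z)))
      \<longleftrightarrow> x - z \<le> 2 / sqrt (2 * real k * (1 - z)) * (1 - z)"
    using assms by (simp add: pos_divide_le_eq)
  then show ?thesis
    using assms by (auto simp: accepts_def algebra_simps zero_less_divide_iff)
qed

text \<open>The loss is majorised by \<open>a * (p - q x)\<close>, and this by a polynomial in
  \<open>x - z\<close>, which is integrated exactly over the window of the rule. Allowing any
  \<open>V\<close> above \<open>clipped_sub m - C\<close> lets the truncated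
  \<open>lower_value\<close> be inserted.\<close>

lemma sub_step:
  fixes z C :: real and m :: nat and V :: "real \<Rightarrow> real"
  defines "p \<equiv> sqrt (2 * real m * (1 - z))"
  defines "a \<equiv> sub_slope p"
  assumes z: "z \<in> {0..1}" and p: "5 \<le> p" and a: "0 \<le> a"
    and Q: "0 \<le> p - a * (p / 2 + 1 / 6 + 1 / p)"
    and ineq: "p / 2 * (1 - 1 / (6 * sqrt (p^2 + 2)) - 4 / (p^2 + 2))
     \<le> p / sqrt (p^2 + 2) * (p - a * (p / 2 + 1 / 6 + 1 / p))"
    and V_ge: "\<And>x. x \<in> {0..1} \<Longrightarrow> clipped_sub m x - C \<le> V x"
    and int: "integrable unit_uniform (window_choice (Suc m) V z)"
  shows "clipped_sub (Suc m) z - C \<le> (\<integral>x. window_choice (Suc m) V z x \<partial>unit_uniform)"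
proof -
  interpret prob_space unit_uniform by (rule prob_space_unit_uniform)
  define y where "y = 1 - z"
  have m: "0 < m" using p by (cases m) (auto simp: p_def)
  have y: "0 < y" "y \<le> 1" using p z by (auto simp: p_def y_def intro: ccontr)
  have p2: "p^2 = 2 * real m * y" using y by (simp add: p_def y_def)
  define P B where "P = sqrt (p^2 + 2 * y)" and "B = sqrt (p^2 + 2)"
  have P: "p \<le> P" "P \<le> B" "P^2 = p^2 + 2 * y" "0 < P"
    using y p by (auto simp: P_def B_def intro: real_le_rsqrt add_pos_pos)
  have B: "B^2 = p^2 + 2" "0 < B" using p by (auto simp: B_def add_nonneg_pos)
  have Pm: "sqrt (2 * real (Suc m) * (1 - z)) = P"
    by (simp add: P_def p2 y_def algebra_simps)
  have Vs: "clipped_sub (Suc m) z = sub_profile P"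
    using P p unfolding clipped_sub_def Pm by simp
  \<comment> \<open>The window is that of \<open>Suc m\<close> items, with argument
    \<open>P\<close>, while the values afterwards belong to \<open>m\<close> items, with argument
    \<open>p\<close>; \<open>t\<close> carries this mismatch. In the variable
    \<open>m * (x - z)\<close> the window ends at \<open>p * t\<close>.\<close>
  define t where "t = p / P"
  have t: "0 \<le> t" "t \<le> 1" "p / B \<le> t" using P p B by (auto simp: t_def intro!: divide_left_mono)
  define d where "d = 2 * y / P"
  have d: "0 \<le> d" "m * d = p * t"
    using y P m p2 by (auto simp: d_def t_def power2_eq_square)
  have "d \<le> y" using P p y by (simp add: d_def pos_divide_le_eq)
  then have b1: "z + d \<le> 1" by (simp add: y_def)
  define q where "q x = sqrt (2 * real m * (1 - x))" for x
  \<comment> \<open>This is \<open>1 - a * (p - q x)\<close> with the bound of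
    \<open>sqrt_drop_le\<close> inserted for \<open>u = m * (x - z)\<close>.\<close>
  define f where "f x = 1 - a * (m * (x - z) / p + (m * (x - z))^2 / (2 * p^3) + 4 * (m * (x - z))^3 / p^5)" for x
  define F where "F x = x - a * (real m / (2 * p) * (x - z)^2 + real m^2 / (6 * p^3) * (x - z)^3
      + real m^3 / p^5 * (x - z)^4)" for x
  have fm: "f \<in> borel_measurable borel" unfolding f_def[abs_def] by measurable
  have "DERIV (\<lambda>x. x - a * (b * (x - z)^2 + c * (x - z)^3 + e * (x - z)^4)) x
      :> 1 - a * (2 * b * (x - z) + 3 * c * (x - z)^2 + 4 * e * (x - z)^3)" for b c e x
    by (auto intro!: derivative_eq_intros simp: algebra_simps)
  note this[of "real m / (2 * p)" "real m^2 / (6 * p^3)" "real m^3 / p^5"]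
  then have der: "DERIV F x :> f x" for x
    unfolding F_def[abs_def] f_def by (simp add: power_mult_distrib mult.assoc)
  have cont: "isCont f x" for x
    unfolding f_def[abs_def] using p by (intro continuous_intros) auto
  have "0 \<le> z" "z \<le> z + d" using z d by auto
  note win = integral_unit_uniform_window[OF fm this b1 der cont]
  have "m * (F (z + d) - F z) = m * d - a * ((m * d)^2 / (2 * p) + (m * d)^3 / (6 * p^3) + (m * d)^4 / p^5)"
    by (simp add: F_def algebra_simps power2_eq_square power3_eq_cube power4_eq_xxxx)
  also have "\<dots> = p * t - a * (p / 2 * t^2 + 1 / 6 * t^3 + 1 / p * t^4)"
    unfolding d using p by (simp add: field_simps eval_nat_numeral)
  \<comment> \<open>As \<open>0 \<le> t \<le> 1\<close>, lowering the exponents to 1 only enlarges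
    what is subtracted, and a common factor \<open>t\<close> appears, for which \<open>p / B\<close>
    is a lower bound.\<close>
  also have "\<dots> \<ge> p * t - a * (p / 2 * t + 1 / 6 * t + 1 / p * t)"
    using a p t power_decreasing[of 1 2 t] power_decreasing[of 1 3 t] power_decreasing[of 1 4 t]
    by (intro diff_left_mono mult_left_mono add_mono) auto
  also have "p * t - a * (p / 2 * t + 1 / 6 * t + 1 / p * t) = t * (p - a * (p / 2 + 1 / 6 + 1 / p))"
    by (simp add: algebra_simps)
  also have "\<dots> \<ge> p / B * (p - a * (p / 2 + 1 / 6 + 1 / p))"
    using t Q by (intro mult_right_mono) auto
  finally have Fd: "p / 2 * (1 - 1 / (6 * B) - 4 / (p^2 + 2)) \<le> m * (F (z + d) - F z)"
    using order_trans[OF ineq[folded B_def]] by blast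
  have V: "clipped_sub m x = sub_profile (max (q x) 3)" for x
    by (simp add: clipped_sub_def q_def)
  have qz: "q z = p" by (simp add: q_def p_def)
  \<comment> \<open>At \<open>x = z\<close> the indicator is 1 although the strict inequality of the
    rule rejects the item; this null set is discarded when integrating.\<close>
  have pw: "clipped_sub m z - C + f x * indicator {z..z + d} x \<le> window_choice (Suc m) V z x"
    if x: "x \<in> {0..1}" and "x \<noteq> z" for x
  proof (cases "z < x \<and> x \<le> z + d")
    case False
    then have "\<not> accepts (Suc m) z x"
      using accepts_iff[of z "Suc m" x] y Pm by (auto simp: y_def d_def)
    then show ?thesis using False V_ge[OF z] \<open>x \<noteq> z\<close> by (auto simp: window_choice_def indicator_def)
  next
    case True
    then have acc: "accepts (Suc m) z x"
      using accepts_iff[of z "Suc m" x] y Pm by (auto simp: y_def d_def)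
    define u where "u = m * (x - z)"
    have u0: "0 \<le> u" using True by (simp add: u_def)
    have "u \<le> m * d" using True by (auto simp: u_def intro!: mult_left_mono)
    also have "\<dots> \<le> p" unfolding d using t p by (simp add: mult_left_le)
    finally have up: "u \<le> p" .
    \<comment> \<open>Together with \<open>u \<le> p\<close> this yields
      \<open>4 * u \<le> p^2\<close>, as the square root bound demands, and
      \<open>p^2 - 2 * u \<ge> 9\<close>, so that \<open>q x\<close> is not clipped.\<close>
    have pp: "5 * p \<le> p^2" using p by (simp add: power2_eq_square)
    have qx: "q x = sqrt (p^2 - 2 * u)"
      by (simp add: q_def p2 u_def y_def algebra_simps)
    have "p - q x \<le> u / p + u^2 / (2 * p^3) + 4 * u^3 / p^5"
      unfolding qx using u0 up pp p by (intro sqrt_drop_le) auto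
    from mult_left_mono[OF this a] have "f x \<le> 1 - a * (p - q x)"
      by (simp add: f_def u_def)
    moreover have "3 \<le> q x"
      unfolding qx using up pp p by (intro real_le_rsqrt) auto
    moreover have "q x \<le> p" unfolding qz[symmetric] using True by (simp add: q_def mult_left_mono)
    ultimately have "f x \<le> 1 + clipped_sub m x - clipped_sub m z"
      using sub_profile_diff_le_slope[of "q x" p] p by (simp add: V qz a_def)
    then show ?thesis using True V_ge[OF x] acc by (simp add: window_choice_def)
  qed
  have "(P - p) * (P + p) = 2 * y" using P(3) by (simp add: algebra_simps power2_eq_square)
  moreover have "(P - p) * (2 * p) \<le> (P - p) * (P + p)" using P by (intro mult_left_mono) auto
  ultimately have "P - p \<le> y / p" using p by (simp add: field_simps)
  also have "y / p = p / 2 / m" using p2 p m by (simp add: field_simps power2_eq_square)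
  finally have Pp: "P - p \<le> p / 2 / m" .
  let ?s = "1 - 1 / (6 * B) - 4 / (p^2 + 2)"
  have "5 \<le> B" using P p by linarith
  then have "1 / (6 * B) \<le> 1 / 6" by (simp add: field_simps)
  moreover have "25 \<le> p^2" using power_mono[of 5 p 2] p by simp
  then have "4 / (p^2 + 2) \<le> 1 / 6" by (simp add: field_simps)
  ultimately have s: "0 \<le> ?s" by linarith
  have "sub_profile P - sub_profile p \<le> (P - p) * ?s"
    using sub_profile_diff_le[of p P B] P p B by simp
  also have "\<dots> \<le> p / 2 / m * ?s" using Pp s by (rule mult_right_mono)
  also have "\<dots> = (p / 2 * ?s) / m" by simp
  also have "\<dots> \<le> F (z + d) - F z" using Fd m by (simp add: pos_divide_le_eq mult.commute)
  finally have "clipped_sub (Suc m) z - C \<le> clipped_sub m z - C + (F (z + d) - F z)"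
    using p by (simp add: Vs V qz)
  also have "\<dots> = (\<integral>x. clipped_sub m z - C + f x * indicator {z..z + d} x \<partial>unit_uniform)"
    using win prob_space by simp
  also have "\<dots> \<le> (\<integral>x. window_choice (Suc m) V z x \<partial>unit_uniform)"
  proof (rule integral_mono_AE)
    have "AE x in unit_uniform. x \<noteq> z"
      by (rule AE_uniform_measureI) (auto intro: eventually_mono[OF AE_lborel_singleton])
    with AE_unit_uniform
    show "AE x in unit_uniform. clipped_sub m z - C + f x * indicator {z..z + d} x \<le> window_choice (Suc m) V z x"
      by eventually_elim (use pw in auto)
  qed (use win int in auto)
  finally show ?thesis .
qed

section \<open>Global supersolution and subsolution\<close>

text \<open>The minimum with the expected number of items above \<open>z\<close> makes \<open>upper_value\<close> a supersolution
  also where the asymptotic inequality fails.\<close>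

definition upper_value :: "real \<Rightarrow> nat \<Rightarrow> real \<Rightarrow> real" where
  "upper_value C k z = min (real k * (1 - z)) (clipped_super k z + C)"

definition lower_value :: "real \<Rightarrow> nat \<Rightarrow> real \<Rightarrow> real" where
  "lower_value C k z = max 0 (clipped_sub k z - C)"

lemma value_measurable [measurable]:
  "upper_value C k \<in> borel_measurable borel" "lower_value C k \<in> borel_measurable borel"
  unfolding upper_value_def[abs_def] lower_value_def[abs_def] by measurable

lemma lower_value_bounded:
  assumes "z \<in> {0..1}" shows "\<bar>lower_value C k z\<bar> \<le> \<bar>clipped_sub k 0\<bar> + \<bar>C\<bar>"
  using clipped_bounds(4)[OF assms, of k] by (auto simp: lower_value_def)

text \<open>\<open>k * (1 - z)\<close> is a supersolution on its own: only an item above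
  \<open>z\<close> can be accepted, and it adds at most 1. For the other entry of the minimum,
  \<open>super_step\<close> and monotonicity of \<open>greedy_choice\<close> settle arguments from
  \<open>P\<close> on; below \<open>P\<close> the choice of \<open>C\<close> makes that entry at
  least \<open>Suc k * (1 - z)\<close>.\<close>

lemma ex_upper_value:
  "\<exists>C. \<forall>k. \<forall>z\<in>{0..1}. 0 \<le> upper_value C k z \<and>
     (\<integral>x. greedy_choice (upper_value C k) z x \<partial>unit_uniform) \<le> upper_value C (Suc k) z"
proof -
  have "eventually (\<lambda>p. 5 \<le> p \<and> 1/2 \<le> super_slope p \<and>
     p / (2 * super_slope p) - 1 / (6 * (super_slope p)^2)
     \<le> p^2 / (2 * sqrt (p^2 + 2)) * (1 - 1 / (6 * p) + 4 / (p^2 + 2))) at_top"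
    using eventually_slopes eventually_super_step eventually_ge_at_top[of 5]
    by eventually_elim auto
  then obtain P where P: "\<And>p. p \<ge> P \<Longrightarrow> 5 \<le> p" "\<And>p. p \<ge> P \<Longrightarrow> 1/2 \<le> super_slope p"
    "\<And>p. p \<ge> P \<Longrightarrow> p / (2 * super_slope p) - 1 / (6 * (super_slope p)^2)
     \<le> p^2 / (2 * sqrt (p^2 + 2)) * (1 - 1 / (6 * p) + 4 / (p^2 + 2))"
    unfolding eventually_at_top_linorder by blast
  \<comment> \<open>Chosen to lift \<open>clipped_super\<close> to at least
    \<open>P^2 / 2 + 1\<close>, which bounds \<open>Suc k * (1 - z)\<close> whenever
    \<open>2 * k * (1 - z) \<le> P^2\<close>.\<close>
  define C where "C = P^2 / 2 + 1 - super_profile 3"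
  have ge: "P^2 / 2 + 1 \<le> clipped_super k z + C" if "z \<in> {0..1}" for k z
    using clipped_bounds(1)[OF that, of k] by (simp add: C_def)
  have nonneg: "0 \<le> upper_value C k z" if "z \<in> {0..1}" for k z
  proof -
    have "0 \<le> P^2 / 2 + 1" by simp
    then show ?thesis using that order_trans[OF _ ge[OF that]] by (simp add: upper_value_def)
  qed
  have "(\<integral>x. greedy_choice (upper_value C k) z x \<partial>unit_uniform) \<le> upper_value C (Suc k) z"
    if z: "z \<in> {0..1}" for k z
  proof -
    interpret prob_space unit_uniform by (rule prob_space_unit_uniform)
    have "upper_value C k x \<le> k" if "x \<in> {0..1}" for x
      using that by (auto simp: upper_value_def min_le_iff_disj mult_left_le)
    then have int: "integrable unit_uniform (greedy_choice (upper_value C k) z)"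
      using nonneg z by (intro choice_integrable[where B = k]) auto
    have fin: "integrable unit_uniform (\<lambda>x. 1 * indicat_real {z..1} x)"
      "(\<integral>x. 1 * indicat_real {z..1} x \<partial>unit_uniform) = 1 - z"
      using integral_unit_uniform_window[of "\<lambda>_. 1" z 1 "\<lambda>x. x"] z by auto
    have "(\<integral>x. greedy_choice (upper_value C k) z x \<partial>unit_uniform)
        \<le> (\<integral>x. real k * (1 - z) + 1 * indicat_real {z..1} x \<partial>unit_uniform)"
    proof (rule integral_mono_AE)
      have "greedy_choice (upper_value C k) z x \<le> real k * (1 - z) + 1 * indicat_real {z..1} x"
        if "x \<in> {0..1}" for x
      proof -
        have "upper_value C k z \<le> real k * (1 - z)" "upper_value C k x \<le> real k * (1 - x)"
          by (auto simp: upper_value_def)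
        moreover have "real k * (1 - x) \<le> real k * (1 - z)" if "z \<le> x"
          using that by (intro mult_left_mono) auto
        ultimately show ?thesis using that by (auto simp: greedy_choice_def)
      qed
      then show "AE x in unit_uniform. greedy_choice (upper_value C k) z x \<le> real k * (1 - z) + 1 * indicat_real {z..1} x"
        by (auto intro: eventually_mono[OF AE_unit_uniform])
    qed (use int fin in auto)
    also have "\<dots> = real (Suc k) * (1 - z)" using fin prob_space by (simp add: algebra_simps)
    finally have le1: "(\<integral>x. greedy_choice (upper_value C k) z x \<partial>unit_uniform) \<le> real (Suc k) * (1 - z)" .
    moreover have "(\<integral>x. greedy_choice (upper_value C k) z x \<partial>unit_uniform) \<le> clipped_super (Suc k) z + C"
    proof (cases "P \<le> sqrt (2 * real k * (1 - z))")
      case True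
      have "(\<integral>x. greedy_choice (upper_value C k) z x \<partial>unit_uniform)
          \<le> (\<integral>x. greedy_choice (\<lambda>x. clipped_super k x + C) z x \<partial>unit_uniform)"
      proof (rule integral_mono)
        show "integrable unit_uniform (greedy_choice (\<lambda>x. clipped_super k x + C) z)"
          using clipped_bounds(1,2)[of _ k] z
          by (intro choice_integrable[where B = "\<bar>super_profile 3\<bar> + \<bar>clipped_super k 0\<bar> + \<bar>C\<bar>"])
            (auto simp: abs_le_iff, smt+)
        fix x
        have "upper_value C k z \<le> clipped_super k z + C" "upper_value C k x \<le> clipped_super k x + C"
          by (auto simp: upper_value_def)
        then show "greedy_choice (upper_value C k) z x \<le> greedy_choice (\<lambda>x. clipped_super k x + C) z x"
          by (auto simp: greedy_choice_def)
      qed (use int in auto)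
      also have "\<dots> \<le> clipped_super (Suc k) z + C"
        by (rule super_step[OF z P(1)[OF True] P(2)[OF True] P(3)[OF True]])
      finally show ?thesis .
    next
      case False
      have "2 * real k * (1 - z) \<le> P^2"
        using False z real_sqrt_le_iff[of "2 * real k * (1 - z)" "P^2"]
        by (intro sqrt_le_D) auto
      then have "real (Suc k) * (1 - z) \<le> P^2 / 2 + 1" using z by (simp add: algebra_simps)
      with le1 ge[OF z, of "Suc k"] show ?thesis by linarith
    qed
    ultimately show ?thesis by (simp add: upper_value_def)
  qed
  with nonneg show ?thesis by blast
qed

text \<open>Where the argument for \<open>Suc k\<close> items is at most \<open>P + 2\<close>, the
  left side is truncated to 0 and the right side is nonnegative; elsewhere the argument for
  \<open>k\<close> items is still at least \<open>P\<close> and \<open>sub_step\<close>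
  applies.\<close>

lemma ex_lower_value:
  "\<exists>C. (\<forall>z\<in>{0..1}. lower_value C 0 z = 0) \<and> (\<forall>k. \<forall>z\<in>{0..1}.
     lower_value C (Suc k) z \<le> (\<integral>x. window_choice (Suc k) (lower_value C k) z x \<partial>unit_uniform))"
proof -
  have "eventually (\<lambda>p. 5 \<le> p \<and> 0 \<le> sub_slope p \<and> 0 \<le> p - sub_slope p * (p / 2 + 1 / 6 + 1 / p) \<and>
     p / 2 * (1 - 1 / (6 * sqrt (p^2 + 2)) - 4 / (p^2 + 2))
     \<le> p / sqrt (p^2 + 2) * (p - sub_slope p * (p / 2 + 1 / 6 + 1 / p))) at_top"
    using eventually_slopes eventually_sub_step eventually_ge_at_top[of 5]
    by eventually_elim auto
  then obtain P where P: "\<And>p. p \<ge> P \<Longrightarrow> 5 \<le> p" "\<And>p. p \<ge> P \<Longrightarrow> 0 \<le> sub_slope p"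
    "\<And>p. p \<ge> P \<Longrightarrow> 0 \<le> p - sub_slope p * (p / 2 + 1 / 6 + 1 / p)"
    "\<And>p. p \<ge> P \<Longrightarrow> p / 2 * (1 - 1 / (6 * sqrt (p^2 + 2)) - 4 / (p^2 + 2))
     \<le> p / sqrt (p^2 + 2) * (p - sub_slope p * (p / 2 + 1 / 6 + 1 / p))"
    unfolding eventually_at_top_linorder by blast
  have P5: "5 \<le> P" using P(1)[of P] by simp
  \<comment> \<open>The margin 2 covers the removal of one item, which lowers the squared argument
    by at most 2.\<close>
  define C where "C = sub_profile (P + 2)"
  have "lower_value C (Suc k) z \<le> (\<integral>x. window_choice (Suc k) (lower_value C k) z x \<partial>unit_uniform)"
    if z: "z \<in> {0..1}" for k z
  proof (cases "sqrt (2 * real (Suc k) * (1 - z)) \<le> P + 2")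
    case True
    then have "clipped_sub (Suc k) z \<le> C"
      unfolding clipped_sub_def C_def using P5 by (intro sub_profile_mono) auto
    then have "lower_value C (Suc k) z = 0" by (simp add: lower_value_def)
    also have "\<dots> \<le> (\<integral>x. window_choice (Suc k) (lower_value C k) z x \<partial>unit_uniform)"
      by (intro Bochner_Integration.integral_nonneg) (auto simp: window_choice_def lower_value_def)
    finally show ?thesis .
  next
    case False
    have int: "integrable unit_uniform (window_choice (Suc k) (lower_value C k) z)"
      using lower_value_bounded z by (intro choice_integrable) auto
    have "(P + 2)^2 \<le> (sqrt (2 * real (Suc k) * (1 - z)))^2"
      using False P5 by (intro power_mono) auto
    then have "(P + 2)^2 \<le> 2 * real (Suc k) * (1 - z)" using z by simp
    moreover have "P^2 + 2 \<le> (P + 2)^2" using P5 by (simp add: power2_eq_square algebra_simps)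
    ultimately have "P^2 \<le> 2 * real k * (1 - z)" using z by (simp add: algebra_simps)
    then have *: "P \<le> sqrt (2 * real k * (1 - z))" by (rule real_le_rsqrt)
    have "clipped_sub (Suc k) z - C \<le> (\<integral>x. window_choice (Suc k) (lower_value C k) z x \<partial>unit_uniform)"
      by (rule sub_step[OF z P(1)[OF *] P(2)[OF *] P(3)[OF *] P(4)[OF *] _ int])
        (auto simp: lower_value_def)
    moreover have "0 \<le> (\<integral>x. window_choice (Suc k) (lower_value C k) z x \<partial>unit_uniform)"
      by (intro Bochner_Integration.integral_nonneg) (auto simp: window_choice_def lower_value_def)
    ultimately show ?thesis by (simp add: lower_value_def)
  qed
  moreover have "lower_value C 0 z = 0" for z
  proof -
    have "sub_profile 3 \<le> C" unfolding C_def using P5 by (intro sub_profile_mono) auto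
    then show ?thesis by (simp add: lower_value_def clipped_sub_def)
  qed
  ultimately show ?thesis by blast
qed

text \<open>The profiles share \<open>p - ln p / 6\<close> and differ only in the sign of
  \<open>4 / p\<close>, so the logarithm cancels and the gap is free of \<open>k\<close> and
  \<open>z\<close>.\<close>

lemma upper_minus_lower_value:
  "upper_value C k z - lower_value D k z \<le> C + D"
proof -
  have "super_profile p \<le> sub_profile p" if "3 \<le> p" for p
    using that by (simp add: super_profile_def sub_profile_def)
  then have "clipped_super k z \<le> clipped_sub k z" by (simp add: clipped_super_def clipped_sub_def)
  then show ?thesis by (auto simp: upper_value_def lower_value_def)
qed

section \<open>Processes driven by independent uniform items\<close>

locale uniform_items = prob_space M for M :: "'a measure" +
  fixes X :: "nat \<Rightarrow> 'a \<Rightarrow> real" and n :: nat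
  assumes indep_items: "indep_vars (\<lambda>_. borel) X {1..n}"
    and distr_item: "\<And>i. i \<in> {1..n} \<Longrightarrow> distr M borel (X i) = unit_uniform"
begin

section \<open>Filtration and the law of the next item\<close>

abbreviation "\<F> \<equiv> item_filtration M X n"

lemma item_rv [measurable]: "i \<in> {1..n} \<Longrightarrow> X i \<in> borel_measurable M"
  using indep_items by (auto simp: indep_vars_def)

lemma space_item_filtration [simp]: "space (\<F> t) = space M"
  by (simp add: item_filtration_def space_measure_of_conv)

text \<open>Grouping the generators by item index gives the form to which independence of disjoint
  blocks applies.\<close>

lemma sets_item_filtration:
  "sets (\<F> t) = sigma_sets (space M)
     (\<Union>i\<in>{i \<in> {1..n}. enat i \<le> t}. {X i -` A \<inter> space M | A. A \<in> sets borel})"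
proof -
  have "{X i -` A \<inter> space M | i A. i \<in> {1..n} \<and> enat i \<le> t \<and> A \<in> sets borel} =
     (\<Union>i\<in>{i \<in> {1..n}. enat i \<le> t}. {X i -` A \<inter> space M | A. A \<in> sets borel})"
    by blast
  then show ?thesis
    unfolding item_filtration_def by (subst sets_measure_of) auto
qed

lemma item_filtration_mono: "s \<le> t \<Longrightarrow> sets (\<F> s) \<subseteq> sets (\<F> t)"
  unfolding sets_item_filtration by (rule sigma_sets_mono') (auto intro: order_trans)

lemma measurable_item_filtration_mono:
  assumes "s \<le> t" "f \<in> measurable (\<F> s) N" shows "f \<in> measurable (\<F> t) N"
  using assms item_filtration_mono[OF assms(1)] by (auto simp: measurable_def)

lemma item_measurable:
  assumes "i \<in> {1..n}" "enat i \<le> t" shows "X i \<in> borel_measurable (\<F> t)"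
  using assms unfolding measurable_def sets_item_filtration
  by (auto intro!: sigma_sets.Basic)

lemma item_filtration_events: "sets (\<F> t) \<subseteq> events"
  unfolding sets_item_filtration
  by (rule sets.sigma_sets_subset) (auto intro!: measurable_sets item_rv)

lemma measurable_item_filtration: "f \<in> measurable (\<F> t) N \<Longrightarrow> f \<in> measurable M N"
  using item_filtration_events[of t] by (auto simp: measurable_def)

text \<open>Items 1 to \<open>i\<close> and item \<open>Suc i\<close> form disjoint blocks with
  intersection-stable generators, hence generate independent \<sigma>-algebras; that of
  \<open>Z\<close> lies in the first.\<close>

lemma indep_next_item:
  assumes "Suc i \<le> n" and Z: "Z \<in> borel_measurable (\<F> (enat i))"
  shows "indep_var borel Z borel (X (Suc i))"
proof -
  let ?E = "\<lambda>i. {X i -` A \<inter> space M | A. A \<in> sets borel}"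
  let ?I = "case_bool {1..i} {Suc i}"
  have 1: "indep_sets ?E (\<Union>b\<in>UNIV. ?I b)"
    using indep_items assms(1) unfolding indep_vars_def2
    by (intro indep_sets_mono_index[of "\<Union>b\<in>UNIV. ?I b" "{1..n}" ?E]) (auto simp: UNIV_bool)
  have 2: "Int_stable (?E j)" for j
  proof (rule Int_stableI)
    fix a b assume "a \<in> ?E j" "b \<in> ?E j"
    then obtain A B where "a = X j -` A \<inter> space M" "b = X j -` B \<inter> space M"
      "A \<in> sets borel" "B \<in> sets borel" by blast
    then have "a \<inter> b = X j -` (A \<inter> B) \<inter> space M" "A \<inter> B \<in> sets borel" by auto
    then show "a \<inter> b \<in> ?E j" by blast
  qed
  have 3: "disjoint_family ?I" unfolding disjoint_family_on_def by (auto split: bool.split)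
  have 4: "indep_sets (\<lambda>b. sigma_sets (space M) (\<Union>j\<in>?I b. ?E j)) UNIV"
    by (rule indep_sets_collect_sigma[where I = ?I and E = ?E, OF 1 2 3])
  have "indep_sets (case_bool
      (sigma_sets (space M) {Z -` A \<inter> space M | A. A \<in> sets borel})
      (sigma_sets (space M) (?E (Suc i)))) UNIV"
  proof (rule indep_sets_mono_sets[OF 4])
    have "{j \<in> {1..n}. enat j \<le> enat i} = {1..i}" using assms(1) by auto
    then have F: "sets (\<F> (enat i)) = sigma_sets (space M) (\<Union>j\<in>{1..i}. ?E j)"
      by (simp add: sets_item_filtration)
    have "{Z -` A \<inter> space M | A. A \<in> sets borel} \<subseteq> sets (\<F> (enat i))"
      using measurable_sets[OF Z] by auto
    from sets.sigma_sets_subset[OF this] show "case_bool (sigma_sets (space M) {Z -` A \<inter> space M | A. A \<in> sets borel})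
        (sigma_sets (space M) (?E (Suc i))) b \<subseteq> sigma_sets (space M) (\<Union>j\<in>?I b. ?E j)" for b
      unfolding F by (cases b) auto
  qed
  then show ?thesis
    unfolding indep_var_eq indep_set_def using assms measurable_item_filtration[OF Z] by auto
qed

lemma AE_item: "i \<in> {1..n} \<Longrightarrow> AE \<omega> in M. X i \<omega> \<in> {0..1}"
  using AE_unit_uniform AE_distrD[OF item_rv, of i "\<lambda>x. x \<in> {0..1}"] by (simp only: distr_item)

lemma AE_items: "AE \<omega> in M. \<forall>i\<in>{1..n}. X i \<omega> \<in> {0..1}"
  by (rule AE_finite_allI) (auto intro: AE_item simp del: atLeastAtMost_iff)

text \<open>This takes the place of conditioning on the past: by independence \<open>Z\<close> and
  the next item have a product law, and Fubini integrates the item out with the state held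
  fixed.\<close>

lemma expectation_next_item:
  fixes \<phi> :: "real \<Rightarrow> real \<Rightarrow> real"
  assumes i: "Suc i \<le> n" and Z: "Z \<in> borel_measurable (\<F> (enat i))"
    and Z01: "AE \<omega> in M. Z \<omega> \<in> {0..1}"
    and \<phi> [measurable]: "(\<lambda>(z, x). \<phi> z x) \<in> borel_measurable (borel \<Otimes>\<^sub>M borel)"
    and B: "\<And>z x. z \<in> {0..1} \<Longrightarrow> x \<in> {0..1} \<Longrightarrow> \<bar>\<phi> z x\<bar> \<le> B"
  shows "integrable M (\<lambda>\<omega>. \<phi> (Z \<omega>) (X (Suc i) \<omega>))"
    and "integrable M (\<lambda>\<omega>. \<integral>x. \<phi> (Z \<omega>) x \<partial>unit_uniform)"
    and "expectation (\<lambda>\<omega>. \<phi> (Z \<omega>) (X (Suc i) \<omega>)) = expectation (\<lambda>\<omega>. \<integral>x. \<phi> (Z \<omega>) x \<partial>unit_uniform)"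
proof -
  let ?X = "X (Suc i)"
  have si: "Suc i \<in> {1..n}" using i by simp
  have [measurable]: "Z \<in> borel_measurable M" "?X \<in> borel_measurable M"
    using measurable_item_filtration[OF Z] item_rv[OF si] by auto
  have D: "distr M borel Z \<Otimes>\<^sub>M unit_uniform = distr M (borel \<Otimes>\<^sub>M borel) (\<lambda>\<omega>. (Z \<omega>, ?X \<omega>))"
    using indep_next_item[OF i Z] distr_item[OF si] unfolding indep_var_distribution_eq by simp
  show int: "integrable M (\<lambda>\<omega>. \<phi> (Z \<omega>) (?X \<omega>))"
  proof (rule integrable_const_bound[where B = B])
    show "AE \<omega> in M. norm (\<phi> (Z \<omega>) (?X \<omega>)) \<le> B"
      using Z01 AE_item[OF si] by eventually_elim (use B in auto)
  qed measurable
  interpret Z: prob_space "distr M borel Z" by (rule prob_space_distr) measurable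
  interpret U: prob_space unit_uniform by (rule prob_space_unit_uniform)
  interpret pair_sigma_finite "distr M borel Z" unit_uniform ..
  have int2: "integrable (distr M borel Z \<Otimes>\<^sub>M unit_uniform) (\<lambda>(z, x). \<phi> z x)"
    unfolding D using int by (simp add: integrable_distr_eq)
  have m2: "(\<lambda>z. \<integral>x. \<phi> z x \<partial>unit_uniform) \<in> borel_measurable borel"
    using borel_measurable_integrable[OF integrable_fst'[OF int2]] by simp
  show "integrable M (\<lambda>\<omega>. \<integral>x. \<phi> (Z \<omega>) x \<partial>unit_uniform)"
    using integrable_fst'[OF int2] m2 by (simp add: integrable_distr_eq)
  have "expectation (\<lambda>\<omega>. \<phi> (Z \<omega>) (?X \<omega>)) = integral\<^sup>L (distr M borel Z \<Otimes>\<^sub>M unit_uniform) (\<lambda>(z, x). \<phi> z x)"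
    unfolding D by (simp add: integral_distr)
  also have "\<dots> = (\<integral>z. \<integral>x. \<phi> z x \<partial>unit_uniform \<partial>distr M borel Z)"
    using integral_fst'[OF int2] by simp
  also have "\<dots> = expectation (\<lambda>\<omega>. \<integral>x. \<phi> (Z \<omega>) x \<partial>unit_uniform)"
    using m2 by (simp add: integral_distr)
  finally show "expectation (\<lambda>\<omega>. \<phi> (Z \<omega>) (?X \<omega>)) = expectation (\<lambda>\<omega>. \<integral>x. \<phi> (Z \<omega>) x \<partial>unit_uniform)" .
qed

section \<open>State and count under a general acceptance rule\<close>

text \<open>The events \<open>S t\<close>, acceptance of item \<open>t\<close>, abstract from the
  policy, so that the heuristic and arbitrary online policies share these processes.\<close>

primrec last_accepted :: "(nat \<Rightarrow> 'a \<Rightarrow> bool) \<Rightarrow> nat \<Rightarrow> 'a \<Rightarrow> real" where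
  "last_accepted S 0 \<omega> = 0"
| "last_accepted S (Suc i) \<omega> = (if S (Suc i) \<omega> then X (Suc i) \<omega> else last_accepted S i \<omega>)"

definition num_accepted :: "(nat \<Rightarrow> 'a \<Rightarrow> bool) \<Rightarrow> nat \<Rightarrow> 'a \<Rightarrow> real" where
  "num_accepted S i \<omega> = (\<Sum>j<i. of_bool (S (Suc j) \<omega>))"

lemma last_accepted_measurable:
  assumes "\<And>i. i \<in> {1..n} \<Longrightarrow> Measurable.pred (\<F> (enat i)) (S i)" "i \<le> n"
  shows "last_accepted S i \<in> borel_measurable (\<F> (enat i))"
  using assms(2)
proof (induction i)
  case (Suc i)
  have [measurable]: "last_accepted S i \<in> borel_measurable (\<F> (enat (Suc i)))"
    by (rule measurable_item_filtration_mono[OF _ Suc.IH]) (use Suc.prems in auto)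
  have [measurable]: "Measurable.pred (\<F> (enat (Suc i))) (S (Suc i))"
    "X (Suc i) \<in> borel_measurable (\<F> (enat (Suc i)))"
    using Suc.prems assms(1) item_measurable by auto
  show ?case by simp
next
  case 0
  show ?case unfolding last_accepted.simps(1)[abs_def] by simp
qed

lemma last_accepted_unit:
  assumes "\<forall>i\<in>{1..n}. X i \<omega> \<in> {0..1}" "i \<le> n"
  shows "last_accepted S i \<omega> \<in> {0..1}"
  using assms by (induction i) auto

lemma AE_last_accepted: "i \<le> n \<Longrightarrow> AE \<omega> in M. last_accepted S i \<omega> \<in> {0..1}"
  using AE_items by eventually_elim (rule last_accepted_unit)

lemma integrable_num_accepted:
  assumes "\<And>i. i \<in> {1..n} \<Longrightarrow> Measurable.pred (\<F> (enat i)) (S i)" "i \<le> n"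
  shows "integrable M (num_accepted S i)"
  unfolding num_accepted_def[abs_def]
proof (rule Bochner_Integration.integrable_sum)
  fix j assume "j \<in> {..<i}"
  then have [measurable]: "Measurable.pred M (S (Suc j))"
    using assms by (intro measurable_item_filtration[of _ "enat (Suc j)"]) auto
  show "integrable M (\<lambda>\<omega>. of_bool (S (Suc j) \<omega>) :: real)"
    by (rule integrable_const_bound[where B = 1]) auto
qed

lemma integrable_last_accepted:
  fixes V :: "real \<Rightarrow> real"
  assumes "\<And>i. i \<in> {1..n} \<Longrightarrow> Measurable.pred (\<F> (enat i)) (S i)" "i \<le> n"
    and "V \<in> borel_measurable borel" "\<And>z. z \<in> {0..1} \<Longrightarrow> \<bar>V z\<bar> \<le> B"
  shows "integrable M (\<lambda>\<omega>. V (last_accepted S i \<omega>))"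
proof (rule integrable_const_bound[where B = B])
  show "AE \<omega> in M. norm (V (last_accepted S i \<omega>)) \<le> B"
    using AE_last_accepted[OF assms(2)] by eventually_elim (use assms(4) in auto)
  show "(\<lambda>\<omega>. V (last_accepted S i \<omega>)) \<in> borel_measurable M"
    using last_accepted_measurable[OF assms(1,2)] measurable_item_filtration assms(3)
    by (blast intro: measurable_compose)
qed

lemma accepted_step:
  "num_accepted S (Suc i) \<omega> + V (last_accepted S (Suc i) \<omega>) =
   num_accepted S i \<omega> + (if S (Suc i) \<omega> then V (X (Suc i) \<omega>) + 1 else V (last_accepted S i \<omega>))"
  by (simp add: num_accepted_def)

section \<open>The heuristic policy\<close>

definition heuristic_accepts :: "nat \<Rightarrow> 'a \<Rightarrow> bool" where
  "heuristic_accepts t \<omega> \<longleftrightarrow>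
     accepts (n - (t - 1)) (last_selected n (\<lambda>i. X i \<omega>) (t - 1)) (X t \<omega>)"

lemma last_accepted_heuristic:
  "last_accepted heuristic_accepts i \<omega> = last_selected n (\<lambda>i. X i \<omega>) i"
  by (induction i) (auto simp: heuristic_accepts_def)

lemma heuristic_accepts_measurable:
  assumes "i \<in> {1..n}" shows "Measurable.pred (\<F> (enat i)) (heuristic_accepts i)"
proof -
  have "(\<lambda>\<omega>. last_selected n (\<lambda>i. X i \<omega>) i) \<in> borel_measurable (\<F> (enat i))" if "i \<le> n" for i
    using that
  proof (induction i)
    case (Suc i)
    have [measurable]: "(\<lambda>\<omega>. last_selected n (\<lambda>i. X i \<omega>) i) \<in> borel_measurable (\<F> (enat (Suc i)))"
      by (rule measurable_item_filtration_mono[OF _ Suc.IH]) (use Suc.prems in auto)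
    have [measurable]: "X (Suc i) \<in> borel_measurable (\<F> (enat (Suc i)))"
      using Suc.prems item_measurable by auto
    show ?case unfolding last_selected.simps accepts_def by measurable
  qed simp
  then have [measurable]: "(\<lambda>\<omega>. last_selected n (\<lambda>i. X i \<omega>) (i - 1)) \<in> borel_measurable (\<F> (enat i))"
    by (rule measurable_item_filtration_mono[of "enat (i - 1)" "enat i", rotated]) (use assms in auto)
  have [measurable]: "X i \<in> borel_measurable (\<F> (enat i))"
    using assms item_measurable by auto
  show ?thesis unfolding heuristic_accepts_def[abs_def] accepts_def by measurable
qed

lemma num_accepted_heuristic:
  "num_accepted heuristic_accepts n \<omega> = real (heuristic_length n (\<lambda>i. X i \<omega>))"
proof -
  have "{i. i < n \<and> accepts (n - i) (last_selected n (\<lambda>i. X i \<omega>) i) (X (Suc i) \<omega>)} =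
     {..<n} \<inter> {i. heuristic_accepts (Suc i) \<omega>}"
    by (auto simp: heuristic_accepts_def)
  then show ?thesis
    by (simp add: num_accepted_def heuristic_length_def sum_of_bool_eq)
qed

text \<open>By \<open>step\<close>, passing one item does not lower the expectation of count plus
  \<open>V\<close> at the state. This expectation starts at \<open>V n 0\<close> and ends at the
  expected length, as \<open>V 0\<close> vanishes.\<close>

lemma heuristic_value_ge:
  fixes V :: "nat \<Rightarrow> real \<Rightarrow> real" and B :: "nat \<Rightarrow> real"
  assumes V [measurable]: "\<And>k. V k \<in> borel_measurable borel"
    and B: "\<And>k z. z \<in> {0..1} \<Longrightarrow> \<bar>V k z\<bar> \<le> B k"
    and V0: "\<And>z. z \<in> {0..1} \<Longrightarrow> V 0 z = 0"
    and step: "\<And>k z. z \<in> {0..1} \<Longrightarrow> V (Suc k) z \<le> (\<integral>x. window_choice (Suc k) (V k) z x \<partial>unit_uniform)"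
  shows "V n 0 \<le> heuristic_value M X n"
proof -
  let ?S = heuristic_accepts
  note meas = heuristic_accepts_measurable
  have "V n 0 \<le> expectation (\<lambda>\<omega>. num_accepted ?S i \<omega> + V (n - i) (last_accepted ?S i \<omega>))" if "i \<le> n" for i
    using that
  proof (induction i)
    case 0
    then show ?case by (simp add: num_accepted_def prob_space)
  next
    case (Suc i)
    define m where "m = n - Suc i"
    have nm: "n - i = Suc m" using Suc.prems by (simp add: m_def)
    have i: "i \<le> n" "Suc i \<le> n" using Suc.prems by auto
    note next_item = expectation_next_item[OF i(2) last_accepted_measurable[OF meas i(1)]
        AE_last_accepted[OF i(1)] choice_measurable(2)[OF V, of "Suc m" m]
        choice_bounded(2)[where V = "V m" and B = "B m", OF B]]
    have int: "integrable M (\<lambda>\<omega>. V (Suc m) (last_accepted ?S i \<omega>))" "integrable M (num_accepted ?S i)"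
      using integrable_last_accepted[OF meas i(1) V B] integrable_num_accepted[OF meas i(1)] by auto
    let ?W = "\<lambda>\<omega>. window_choice (Suc m) (V m) (last_accepted ?S i \<omega>) (X (Suc i) \<omega>)"
    have eq: "expectation ?W = expectation (\<lambda>\<omega>. \<integral>x. window_choice (Suc m) (V m) (last_accepted ?S i \<omega>) x \<partial>unit_uniform)"
      by (rule next_item(3))
    have 1: "V n 0 \<le> expectation (\<lambda>\<omega>. num_accepted ?S i \<omega> + V (Suc m) (last_accepted ?S i \<omega>))"
      using Suc.IH i(1) nm by simp
    have 2: "expectation (\<lambda>\<omega>. num_accepted ?S i \<omega> + V (Suc m) (last_accepted ?S i \<omega>)) =
        expectation (num_accepted ?S i) + expectation (\<lambda>\<omega>. V (Suc m) (last_accepted ?S i \<omega>))"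
      using int(2,1) by (rule Bochner_Integration.integral_add)
    have 3: "expectation (\<lambda>\<omega>. V (Suc m) (last_accepted ?S i \<omega>)) \<le> expectation ?W"
      unfolding eq
    proof (rule integral_mono_AE[OF int(1) next_item(2)])
      show "AE \<omega> in M. V (Suc m) (last_accepted ?S i \<omega>)
          \<le> (\<integral>x. window_choice (Suc m) (V m) (last_accepted ?S i \<omega>) x \<partial>unit_uniform)"
        using AE_last_accepted[OF i(1)] by eventually_elim (rule step)
    qed
    have 4: "expectation (\<lambda>\<omega>. num_accepted ?S i \<omega> + ?W \<omega>) = expectation (num_accepted ?S i) + expectation ?W"
      using int(2) next_item(1) by (rule Bochner_Integration.integral_add)
    \<comment> \<open>By \<open>nm\<close>, item \<open>Suc i\<close> is the
      \<open>Suc m\<close>-th-to-last, so \<open>window_choice\<close> reproduces the decision of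
      the policy exactly.\<close>
    have 5: "expectation (\<lambda>\<omega>. num_accepted ?S i \<omega> + ?W \<omega>) =
        expectation (\<lambda>\<omega>. num_accepted ?S (Suc i) \<omega> + V m (last_accepted ?S (Suc i) \<omega>))"
      unfolding accepted_step
      by (intro Bochner_Integration.integral_cong refl)
        (auto simp: window_choice_def heuristic_accepts_def last_accepted_heuristic nm)
    show ?case using 1 2 3 4 5 unfolding m_def by linarith
  qed
  from this[of n] have "V n 0 \<le> expectation (\<lambda>\<omega>. num_accepted ?S n \<omega> + V 0 (last_accepted ?S n \<omega>))"
    by simp
  also have "\<dots> = heuristic_value M X n"
    unfolding heuristic_value_def
  proof (rule integral_cong_AE)
    show "AE \<omega> in M. num_accepted ?S n \<omega> + V 0 (last_accepted ?S n \<omega>) = real (heuristic_length n (\<lambda>i. X i \<omega>))"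
      using AE_last_accepted[OF order_refl, of ?S] by eventually_elim (simp only: V0 num_accepted_heuristic add_0_right)
    show "(\<lambda>\<omega>. num_accepted ?S n \<omega> + V 0 (last_accepted ?S n \<omega>)) \<in> borel_measurable M"
      using integrable_last_accepted[OF meas order_refl V B] integrable_num_accepted[OF meas order_refl]
      by (intro borel_measurable_add borel_measurable_integrable)
    show "(\<lambda>\<omega>. real (heuristic_length n (\<lambda>i. X i \<omega>))) \<in> borel_measurable M"
      using borel_measurable_integrable[OF integrable_num_accepted[OF meas order_refl]]
      by (simp add: num_accepted_heuristic[abs_def])
  qed
  finally show ?thesis .
qed

section \<open>Arbitrary online policies\<close>

definition policy_selects :: "(nat \<Rightarrow> 'a \<Rightarrow> enat) \<Rightarrow> nat \<Rightarrow> 'a \<Rightarrow> bool" where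
  "policy_selects \<tau> t \<omega> \<longleftrightarrow> (\<exists>j\<ge>1. \<tau> j \<omega> = enat t)"

text \<open>\<open>\<tau> j = i\<close> means \<open>\<tau> j \<le> i\<close> without
  \<open>\<tau> j \<le> i - 1\<close>; both events are known at time \<open>i\<close>, and the union
  over \<open>j\<close> is countable.\<close>

lemma policy_selects_measurable:
  assumes "online_policy M X n \<tau>" "i \<in> {1..n}"
  shows "Measurable.pred (\<F> (enat i)) (policy_selects \<tau> i)"
proof -
  have [measurable]: "Measurable.pred (\<F> (enat i)) (\<lambda>\<omega>. \<tau> (Suc j) \<omega> \<le> enat k)" if "k \<le> i" for j k
  proof (rule measurable_item_filtration_mono[of "enat k"])
    show "Measurable.pred (\<F> (enat k)) (\<lambda>\<omega>. \<tau> (Suc j) \<omega> \<le> enat k)"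
      using assms(1) unfolding online_policy_def by (intro stopping_timeD) simp
  qed (use that in simp)
  have "\<tau> j \<omega> = enat i \<longleftrightarrow> \<tau> j \<omega> \<le> enat i \<and> \<not> \<tau> j \<omega> \<le> enat (i - 1)" for j \<omega>
    using assms(2) by (cases "\<tau> j \<omega>") auto
  moreover have "(\<exists>j\<ge>1. P j) \<longleftrightarrow> (\<exists>j. P (Suc j))" for P
    by (metis Suc_le_D One_nat_def le_add1 plus_1_eq_Suc)
  ultimately have "policy_selects \<tau> i = (\<lambda>\<omega>. \<exists>j. \<tau> (Suc j) \<omega> \<le> enat i \<and> \<not> \<tau> (Suc j) \<omega> \<le> enat (i - 1))"
    by (simp add: policy_selects_def fun_eq_iff)
  moreover have "Measurable.pred (\<F> (enat i)) \<dots>"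
    by measurable
  ultimately show ?thesis by simp
qed

lemma online_policyD:
  assumes "online_policy M X n \<tau>" "1 \<le> j" "\<omega> \<in> space M"
  shows "\<tau> j \<omega> \<in> insert \<infinity> (enat ` {1..n})"
    and "\<tau> (Suc j) \<omega> \<noteq> \<infinity> \<Longrightarrow> \<tau> j \<omega> < \<tau> (Suc j) \<omega>"
    and "\<tau> (Suc j) \<omega> \<noteq> \<infinity> \<Longrightarrow> X (the_enat (\<tau> j \<omega>)) \<omega> < X (the_enat (\<tau> (Suc j) \<omega>)) \<omega>"
proof -
  note * = conjunct2[OF assms(1)[unfolded online_policy_def], THEN spec, THEN mp, OF assms(2),
      THEN bspec, OF assms(3)]
  show "\<tau> j \<omega> \<in> insert \<infinity> (enat ` {1..n})" using * by (rule conjunct1)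
  show "\<tau> j \<omega> < \<tau> (Suc j) \<omega>" if "\<tau> (Suc j) \<omega> \<noteq> \<infinity>"
    using *[THEN conjunct2, THEN conjunct1] that by metis
  show "X (the_enat (\<tau> j \<omega>)) \<omega> < X (the_enat (\<tau> (Suc j) \<omega>)) \<omega>" if "\<tau> (Suc j) \<omega> \<noteq> \<infinity>"
    using *[THEN conjunct2, THEN conjunct2] that by (rule mp)
qed

text \<open>A policy is constrained only between neighbouring selections; the comparisons chain
  because a finite \<open>\<tau> (Suc k)\<close> forces a finite \<open>\<tau> k\<close>.\<close>

lemma policy_increasing:
  assumes "online_policy M X n \<tau>" "\<omega> \<in> space M" "1 \<le> j" "j < j'" "\<tau> j' \<omega> \<noteq> \<infinity>"
  shows "\<tau> j \<omega> < \<tau> j' \<omega> \<and> X (the_enat (\<tau> j \<omega>)) \<omega> < X (the_enat (\<tau> j' \<omega>)) \<omega>"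
  using assms(4,5)
proof (induction j')
  case (Suc k)
  have "1 \<le> k" using assms(3) Suc.prems by simp
  then have k: "\<tau> k \<omega> < \<tau> (Suc k) \<omega>" "X (the_enat (\<tau> k \<omega>)) \<omega> < X (the_enat (\<tau> (Suc k) \<omega>)) \<omega>"
    using online_policyD[OF assms(1) _ assms(2)] Suc.prems by auto
  show ?case
  proof (cases "j = k")
    case False
    moreover have "\<tau> k \<omega> \<noteq> \<infinity>" using k(1) by (cases "\<tau> k \<omega>") auto
    ultimately have "\<tau> j \<omega> < \<tau> k \<omega> \<and> X (the_enat (\<tau> j \<omega>)) \<omega> < X (the_enat (\<tau> k \<omega>)) \<omega>"
      using Suc.prems by (intro Suc.IH) auto
    then show ?thesis using k by (auto intro: less_trans)
  qed (use k in simp)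
qed simp

text \<open>Quantifying over all later selections makes the statement inductive in \<open>i\<close>.\<close>

lemma last_accepted_policy_le:
  assumes pol: "online_policy M X n \<tau>" and \<omega>: "\<omega> \<in> space M" "\<forall>i\<in>{1..n}. X i \<omega> \<in> {0..1}"
    and "policy_selects \<tau> t \<omega>" "i < t" "t \<le> n"
  shows "last_accepted (policy_selects \<tau>) i \<omega> \<le> X t \<omega>"
  using assms(4-6)
proof (induction i)
  case 0
  then show ?case using \<omega>(2) by auto
next
  case (Suc i)
  show ?case
  proof (cases "policy_selects \<tau> (Suc i) \<omega>")
    case True
    then obtain j j' where j: "1 \<le> j" "\<tau> j \<omega> = enat (Suc i)" "1 \<le> j'" "\<tau> j' \<omega> = enat t"
      using Suc.prems by (auto simp: policy_selects_def)
    have "j < j'"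
    proof (rule ccontr)
      assume "\<not> j < j'"
      then consider "j = j'" | "j' < j" by linarith
      then show False
        using policy_increasing[OF pol \<omega>(1) j(3), of j] j Suc.prems by cases auto
    qed
    from policy_increasing[OF pol \<omega>(1) j(1) this] j True show ?thesis by simp
  qed (use Suc in auto)
qed

lemma selected_length_le_num_accepted:
  assumes pol: "online_policy M X n \<tau>" and \<omega>: "\<omega> \<in> space M"
  shows "real (selected_length n \<tau> \<omega>) \<le> num_accepted (policy_selects \<tau>) n \<omega>"
proof -
  let ?J = "{j. 1 \<le> j \<and> \<tau> j \<omega> \<le> enat n}"
  let ?T = "{..<n} \<inter> {i. policy_selects \<tau> (Suc i) \<omega>}"
  define idx where "idx j = the_enat (\<tau> j \<omega>) - 1" for j
  have fin: "\<exists>t\<in>{1..n}. \<tau> j \<omega> = enat t" if "j \<in> ?J" for j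
  proof -
    have "\<tau> j \<omega> \<in> insert \<infinity> (enat ` {1..n})" using that online_policyD(1)[OF pol _ \<omega>] by blast
    then show ?thesis using that by auto
  qed
  have inj: "inj_on idx ?J"
  proof (rule linorder_inj_onI')
    fix j k assume jk: "j \<in> ?J" "k \<in> ?J" "j < k"
    have "\<tau> j \<omega> < \<tau> k \<omega>"
      using policy_increasing[OF pol \<omega>, of j k] jk fin[OF jk(2)] by auto
    then show "idx j \<noteq> idx k" using fin[OF jk(1)] fin[OF jk(2)] by (auto simp: idx_def)
  qed
  have sub: "idx ` ?J \<subseteq> ?T"
  proof (rule image_subsetI)
    fix j assume j: "j \<in> ?J"
    from fin[OF j] obtain t where "t \<in> {1..n}" "\<tau> j \<omega> = enat t" by blast
    with j show "idx j \<in> ?T" by (auto simp: idx_def policy_selects_def)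
  qed
  \<comment> \<open>Finiteness makes \<open>Max\<close> in the selected length an actual
    maximum.\<close>
  have finJ: "finite ?J" using inj sub by (rule inj_on_finite) simp
  have "selected_length n \<tau> \<omega> \<le> card ?J"
  proof -
    define k where "k = selected_length n \<tau> \<omega>"
    have "k \<in> insert 0 ?J" unfolding k_def selected_length_def using finJ by (intro Max_in) auto
    moreover have "{1..k} \<subseteq> ?J" if "k \<in> ?J"
    proof
      fix j assume j: "j \<in> {1..k}"
      have "\<tau> j \<omega> \<le> \<tau> k \<omega>"
        using policy_increasing[OF pol \<omega>, of j k] j fin[OF that] by (cases "j = k") auto
      also have "\<dots> \<le> enat n" using that by simp
      finally show "j \<in> ?J" using j by simp
    qed
    ultimately have "{1..k} \<subseteq> ?J" by (cases "k = 0") auto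
    from card_mono[OF finJ this] show ?thesis by (simp add: k_def)
  qed
  also have "\<dots> \<le> card ?T" using inj sub by (rule card_inj_on_le) simp
  finally show ?thesis by (simp add: num_accepted_def sum_of_bool_eq)
qed

lemma policy_value_le:
  fixes V :: "nat \<Rightarrow> real \<Rightarrow> real" and B :: "nat \<Rightarrow> real"
  assumes pol: "online_policy M X n \<tau>"
    and V [measurable]: "\<And>k. V k \<in> borel_measurable borel"
    and B: "\<And>k z. z \<in> {0..1} \<Longrightarrow> \<bar>V k z\<bar> \<le> B k"
    and V0: "\<And>z. z \<in> {0..1} \<Longrightarrow> 0 \<le> V 0 z"
    and step: "\<And>k z. z \<in> {0..1} \<Longrightarrow> (\<integral>x. greedy_choice (V k) z x \<partial>unit_uniform) \<le> V (Suc k) z"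
  shows "(\<integral>\<omega>. real (selected_length n \<tau> \<omega>) \<partial>M) \<le> V n 0"
proof -
  let ?S = "policy_selects \<tau>"
  note meas = policy_selects_measurable[OF pol]
  have "expectation (\<lambda>\<omega>. num_accepted ?S i \<omega> + V (n - i) (last_accepted ?S i \<omega>)) \<le> V n 0" if "i \<le> n" for i
    using that
  proof (induction i)
    case 0
    then show ?case by (simp add: num_accepted_def prob_space)
  next
    case (Suc i)
    define m where "m = n - Suc i"
    have nm: "n - i = Suc m" using Suc.prems by (simp add: m_def)
    have i: "i \<le> n" "Suc i \<le> n" using Suc.prems by auto
    note next_item = expectation_next_item[OF i(2) last_accepted_measurable[OF meas i(1)]
        AE_last_accepted[OF i(1)] choice_measurable(1)[OF V, of m]
        choice_bounded(1)[where V = "V m" and B = "B m", OF B]]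
    have int: "integrable M (\<lambda>\<omega>. V (Suc m) (last_accepted ?S i \<omega>))" "integrable M (num_accepted ?S i)"
      "integrable M (\<lambda>\<omega>. V m (last_accepted ?S (Suc i) \<omega>))" "integrable M (num_accepted ?S (Suc i))"
      using integrable_last_accepted[OF meas i(1) V B] integrable_num_accepted[OF meas i(1)]
        integrable_last_accepted[OF meas i(2) V B] integrable_num_accepted[OF meas i(2)] by auto
    let ?W = "\<lambda>\<omega>. greedy_choice (V m) (last_accepted ?S i \<omega>) (X (Suc i) \<omega>)"
    have eq: "expectation ?W = expectation (\<lambda>\<omega>. \<integral>x. greedy_choice (V m) (last_accepted ?S i \<omega>) x \<partial>unit_uniform)"
      by (rule next_item(3))
    \<comment> \<open>\<open>greedy_choice\<close> dominates any decision of the policy: a selected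
      item is almost surely not below the state, so acceptance is covered by the maximum, and
      rejection always is.\<close>
    have 1: "expectation (\<lambda>\<omega>. num_accepted ?S (Suc i) \<omega> + V m (last_accepted ?S (Suc i) \<omega>))
        \<le> expectation (\<lambda>\<omega>. num_accepted ?S i \<omega> + ?W \<omega>)"
    proof (rule integral_mono_AE)
      show "AE \<omega> in M. num_accepted ?S (Suc i) \<omega> + V m (last_accepted ?S (Suc i) \<omega>)
          \<le> num_accepted ?S i \<omega> + ?W \<omega>"
        using AE_items AE_space
      proof eventually_elim
        case (elim \<omega>)
        then show ?case
          unfolding accepted_step using last_accepted_policy_le[OF pol elim(2,1), of "Suc i" i] i
          by (auto simp: greedy_choice_def)
      qed
    qed (intro Bochner_Integration.integrable_add int next_item(1))+
    have 2: "expectation (\<lambda>\<omega>. num_accepted ?S i \<omega> + ?W \<omega>) = expectation (num_accepted ?S i) + expectation ?W"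
      using int(2) next_item(1) by (rule Bochner_Integration.integral_add)
    have 3: "expectation ?W \<le> expectation (\<lambda>\<omega>. V (Suc m) (last_accepted ?S i \<omega>))"
      unfolding eq
    proof (rule integral_mono_AE[OF next_item(2) int(1)])
      show "AE \<omega> in M. (\<integral>x. greedy_choice (V m) (last_accepted ?S i \<omega>) x \<partial>unit_uniform)
          \<le> V (Suc m) (last_accepted ?S i \<omega>)"
        using AE_last_accepted[OF i(1)] by eventually_elim (rule step)
    qed
    have 4: "expectation (\<lambda>\<omega>. num_accepted ?S i \<omega> + V (Suc m) (last_accepted ?S i \<omega>)) =
        expectation (num_accepted ?S i) + expectation (\<lambda>\<omega>. V (Suc m) (last_accepted ?S i \<omega>))"
      using int(2,1) by (rule Bochner_Integration.integral_add)
    have 5: "expectation (\<lambda>\<omega>. num_accepted ?S i \<omega> + V (Suc m) (last_accepted ?S i \<omega>)) \<le> V n 0"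
      using Suc.IH i(1) nm by simp
    show ?case using 1 2 3 4 5 unfolding m_def by linarith
  qed
  from this[of n] have le: "expectation (\<lambda>\<omega>. num_accepted ?S n \<omega> + V 0 (last_accepted ?S n \<omega>)) \<le> V n 0"
    by simp
  have "(\<integral>\<omega>. real (selected_length n \<tau> \<omega>) \<partial>M)
      \<le> expectation (\<lambda>\<omega>. num_accepted ?S n \<omega> + V 0 (last_accepted ?S n \<omega>))"
  \<comment> \<open>A nonnegative integrable majorant suffices here, since a non-integrable function
    has integral 0 by convention.\<close>
  proof (rule integral_mono_AE')
    show "AE \<omega> in M. real (selected_length n \<tau> \<omega>) \<le> num_accepted ?S n \<omega> + V 0 (last_accepted ?S n \<omega>)"
      using AE_last_accepted[OF order_refl, of ?S] AE_space
    proof eventually_elim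
      case (elim \<omega>)
      show ?case using V0[OF elim(1)] selected_length_le_num_accepted[OF pol elim(2)] by linarith
    qed
    then show "AE \<omega> in M. 0 \<le> num_accepted ?S n \<omega> + V 0 (last_accepted ?S n \<omega>)"
      by eventually_elim (rule order_trans[OF of_nat_0_le_iff])
    show "integrable M (\<lambda>\<omega>. num_accepted ?S n \<omega> + V 0 (last_accepted ?S n \<omega>))"
      by (intro Bochner_Integration.integrable_add integrable_last_accepted[OF meas order_refl V B]
          integrable_num_accepted[OF meas order_refl])
  qed
  with le show ?thesis by linarith
qed

lemma optimal_value_le:
  assumes "\<And>\<tau>. online_policy M X n \<tau> \<Longrightarrow> (\<integral>\<omega>. real (selected_length n \<tau> \<omega>) \<partial>M) \<le> v"
  shows "optimal_value M X n \<le> v"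
  unfolding optimal_value_def
proof (rule cSUP_least)
  \<comment> \<open>The policy that never selects makes the index set of the real supremum
    nonempty.\<close>
  have "online_policy M X n (\<lambda>_ _. \<infinity>)"
    by (auto simp: online_policy_def stopping_time_def)
  then show "{\<tau>. online_policy M X n \<tau>} \<noteq> {}" by blast
qed (use assms in auto)

end

section \<open>Uniform bound on the gap between the two values\<close>

theorem mainTheorem2:
  fixes M :: "nat \<Rightarrow> 'a measure" and X :: "nat \<Rightarrow> nat \<Rightarrow> 'a \<Rightarrow> real"
  assumes "\<And>n. n \<ge> 1 \<Longrightarrow> prob_space (M n)"
    and "\<And>n. n \<ge> 1 \<Longrightarrow> prob_space.indep_vars (M n) (\<lambda>_. borel) (X n) {1..n}"
    and "\<And>n i. n \<ge> 1 \<Longrightarrow> i \<in> {1..n} \<Longrightarrow>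
           distr (M n) borel (X n i) = uniform_measure lborel {0..1}"
  shows "(SUP n\<in>{1..}. ereal (optimal_value (M n) (X n) n - heuristic_value (M n) (X n) n)) < \<infinity>"
proof -
  \<comment> \<open>\<open>C\<close> and \<open>D\<close> are fixed before \<open>n\<close>, which
    makes the bound \<open>C + D\<close> uniform.\<close>
  obtain C where C: "\<And>k z. z \<in> {0..1} \<Longrightarrow> 0 \<le> upper_value C k z"
    "\<And>k z. z \<in> {0..1} \<Longrightarrow>
       (\<integral>x. greedy_choice (upper_value C k) z x \<partial>unit_uniform) \<le> upper_value C (Suc k) z"
    using ex_upper_value by blast
  obtain D where D: "\<And>z. z \<in> {0..1} \<Longrightarrow> lower_value D 0 z = 0"
    "\<And>k z. z \<in> {0..1} \<Longrightarrow>
       lower_value D (Suc k) z \<le> (\<integral>x. window_choice (Suc k) (lower_value D k) z x \<partial>unit_uniform)"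
    using ex_lower_value by blast
  have "optimal_value (M n) (X n) n - heuristic_value (M n) (X n) n \<le> C + D" if "n \<ge> 1" for n
  proof -
    interpret uniform_items "M n" "X n" n
      unfolding uniform_items_def uniform_items_axioms_def using assms that by blast
    have "\<bar>upper_value C k z\<bar> \<le> real k" if "z \<in> {0..1}" for k z
      using C(1)[OF that, of k] that by (auto simp: upper_value_def min_le_iff_disj mult_left_le)
    then have "optimal_value (M n) (X n) n \<le> upper_value C n 0"
      by (intro optimal_value_le policy_value_le[where B = real]) (use C in auto)
    moreover have "lower_value D n 0 \<le> heuristic_value (M n) (X n) n"
      by (rule heuristic_value_ge[OF _ lower_value_bounded]) (use D in auto)
    ultimately show ?thesis using upper_minus_lower_value[of C n 0 D] by linarith
  qed
  then have "(SUP n\<in>{1..}. ereal (optimal_value (M n) (X n) n - heuristic_value (M n) (X n) n)) \<le> ereal (C + D)"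
    by (intro SUP_least) auto
  then show ?thesis by (rule le_less_trans) simp
qed

end
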